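(* Let $\gamma:=\mu\circ\log:C^*_\cup([0,1])\to\Omega^*([0,1])$. The Taylor coefficients of the unital $A_\infty$ morphism $\gamma$ are determined as follows: (i) the linear part $\gamma_1$ is the inclusion $C^*([0,1])\hookrightarrow\Omega^*([0,1])$; (ii) for all $i\ge0$, $j\ge0$, $$\gamma_{i+j+1}\big((\mathbf{s}dt)^{\otimes i}\otimes\mathbf{s}t\otimes(\mathbf{s}dt)^{\otimes j}\big)=\mathbf{s}\sum_{l=0}^{i}\binom{1-t}{l}\binom{t}{i+j+1-l},$$ where $\binom{\tau}{n}=\frac{\tau(\tau-1)\cdots(\tau-n+1)}{n!}$; (iii) for all $n\ge1$, $$\gamma_n(\mathbf{s}dt\otimes\cdots\otimes\mathbf{s}dt)=\frac{(-1)^{n+1}}{n}\,\mathbf{s}dt .$$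
   Context: **$A_\infty$ conventions.** $\Bbbk$ is a field of characteristic zero. For a graded vector space $V$, $\mathbf{s}V$ is the suspension, $(\mathbf{s}V)^i=V^{i+1}$. $\overline{T}(V)=\bigoplus_{n\ge1}V^{\otimes n}$ carries the deconcatenation coproduct. An $A_\infty$ algebra structure on $V$ is a degree $1$ coderivation $Q$ of $\overline{T}(\mathbf{s}V)$ with $Q^2=0$; it is determined by its Taylor coefficients $Q_n:(\mathbf{s}V)^{\otimes n}\to\mathbf{s}V$. An $A_\infty$ morphism $F:V\to W$ is a morphism of dg coalgebras $\overline{T}(\mathbf{s}V)\to\overline{T}(\mathbf{s}W)$, determined by its Taylor coefficients $F_n:(\mathbf{s}V)^{\otimes n}\to\mathbf{s}W$; the composition has coefficients $(G\circ F)_n=\sum_{k}\sum_{i_1+\cdots+i_k=n}G_k(F_{i_1}\otimes\cdots\otimes F_{i_k})$. A dg algebra is an $A_\infty$ algebra via $Q_1(\mathbf{s}a)=-\mathbf{s}(da)$, $Q_2(\mathbf{s}a\otimes\mathbf{s}b)=(-1)^{|a|}\mathbf{s}(ab)$, $Q_n=0$ for $n\ge3$. Unitality is strict: $Q_2(\mathbf{s}1\otimes\mathbf{s}x)=\mathbf{s}x$, $Q_2(\mathbf{s}x\otimes\mathbf{s}1)=(-1)^{|x|}\mathbf{s}x$, $Q_n$ ($n\neq2$) vanishes if an argument is $\mathbf{s}1$; $F$ is unital if $F_1(\mathbf{s}1)=\mathbf{s}1$ and $F_n$ ($n\ge2$) vanishes if an argument is $\mathbf{s}1$. **Forms and cochains.**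 $\Omega^*([0,1])$ is either the commutative dg algebra of smooth real forms on $[0,1]$ ($\Bbbk=\mathbb{R}$) or that of polynomial forms $\Bbbk[t]\oplus\Bbbk[t]dt$. $C^*([0,1])\subset\Omega^*([0,1])$ is the subcomplex of Whitney forms $\{at+b(1-t)\}\oplus\{c\,dt\}$, $a,b,c\in\Bbbk$. $C^*_\cup([0,1])$ is the dg algebra $(C^*([0,1]),d,\cup)$ with unit the constant function $1$ and $t\cup t=t$, $t\cup dt=0$, $dt\cup t=dt$. $C^*_\infty([0,1])$ is $C^*([0,1])$ with the unital $C_\infty$ (in particular $A_\infty$) structure with Taylor coefficients: $m_1(\mathbf{s}t)=-\mathbf{s}dt$, $m_2(\mathbf{s}t\otimes\mathbf{s}t)=\mathbf{s}t$, $m_2(\mathbf{s}t\otimes\mathbf{s}dt)=\frac12\mathbf{s}dt=-m_2(\mathbf{s}dt\otimes\mathbf{s}t)$, and for $n>1$, $m_{n+1}$ vanishes unless precisely one argument is a function, with $m_{n+1}((\mathbf{s}dt)^{\otimes i}\otimes\mathbf{s}t\otimes(\mathbf{s}dt)^{\otimes n-i})=(-1)^{i+1}\binom{n}{i}\frac{B_n}{n!}\mathbf{s}dt$, where $\frac{z}{e^z-1}=\sum_{n\ge0}\frac{B_n}{n!}z^n$. **The morphism $\mu$** is the unital $C_\infty$ morphism $C^*_\infty([0,1])\to\Omega^*([0,1])$ with $\mu_1$ the inclusion and, for $n\ge1$, $\mu_{n+1}$ vanishing unless precisely one input is a function, with $\mu_{n+1}((\mathbf{s}dt)^{\otimes i}\otimes\mathbf{s}t\otimes(\mathbf{s}dt)^{\otimes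 n-i})=\mathbf{s}\left((-1)^i\binom{n}{i}\frac{B_{n+1}(t)-B_{n+1}}{(n+1)!}\right)$, where $\frac{ze^{tz}}{e^z-1}=\sum_{n\ge0}\frac{B_n(t)}{n!}z^n$. **The morphism $\log$** is the unital $A_\infty$ isomorphism $C^*_\cup([0,1])\to C^*_\infty([0,1])$ with $\log_1=\mathrm{id}$, $\log_n$ ($n>1$) vanishing if some factor is a zero-form, and $\log_n((\mathbf{s}dt)^{\otimes n})=\frac{(-1)^{n+1}}{n}\mathbf{s}dt$ for $n\ge1$. *)

theory Defs
  imports
    "HOL-Analysis.Analysis"
    "HOL-Computational_Algebra.Computational_Algebra"
    "HOL-Library.Function_Algebras"
begin

section \<open>A-infinity algebras and morphisms via Taylor coefficients\<close>

text \<open>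
  A graded vector space \<open>V\<close> is given by a scalar multiplication on the type \<open>'v\<close> and
  the family of its homogeneous parts \<open>V i\<close>; all degrees recorded are degrees in \<open>V\<close>.
  Since \<open>V\<close> and its suspension have the same underlying vectors, an element \<open>s x\<close> of the
  suspension is written \<open>x\<close>; if \<open>x\<close> lies in \<open>V d\<close>, then \<open>s x\<close> has degree \<open>d - 1\<close>.
  A family of maps \<open>F\<^sub>n\<close> on the \<open>n\<close>-th tensor power (\<open>n \<ge> 1\<close>) is a function \<open>F\<close> on lists,
  multilinear in the entries, where \<open>F [x\<^sub>1, \<dots>, x\<^sub>n]\<close> stands for
  \<open>F\<^sub>n (s x\<^sub>1 \<otimes> \<dots> \<otimes> s x\<^sub>n)\<close>. The value at the empty list is irrelevant.
\<close>

record ('k, 'v) ainf =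
  scal :: "'k \<Rightarrow> 'v \<Rightarrow> 'v"
  part :: "int \<Rightarrow> 'v set"
  opn :: "'v list \<Rightarrow> 'v"
  unt :: "'v"

definition total_space :: "('k::field, 'v::ab_group_add) ainf \<Rightarrow> 'v set" where
  "total_space A = module.span (scal A) (\<Union>i. part A i)"

definition graded_vector_space :: "('k::field, 'v::ab_group_add) ainf \<Rightarrow> bool" where
  "graded_vector_space A \<longleftrightarrow>
     vector_space (scal A) \<and>
     (\<forall>i. module.subspace (scal A) (part A i)) \<and>
     (\<forall>I x. finite I \<and> (\<forall>i\<in>I. x i \<in> part A i) \<and> (\<Sum>i\<in>I. x i) = 0 \<longrightarrow> (\<forall>i\<in>I. x i = 0))"

definition multilinear ::
    "('k::field, 'v::ab_group_add) ainf \<Rightarrow> ('k, 'w::ab_group_add) ainf \<Rightarrow> ('v list \<Rightarrow> 'w) \<Rightarrow> bool" where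
  "multilinear A B F \<longleftrightarrow>
     (\<forall>us vs x y c. set us \<subseteq> total_space A \<and> set vs \<subseteq> total_space A \<and>
        x \<in> total_space A \<and> y \<in> total_space A \<longrightarrow>
        F (us @ (x + y) # vs) = F (us @ x # vs) + F (us @ y # vs) \<and>
        F (us @ scal A c x # vs) = scal B c (F (us @ x # vs)))"

definition has_degrees :: "('k, 'v) ainf \<Rightarrow> 'v list \<Rightarrow> int list \<Rightarrow> bool" where
  "has_degrees A xs ds \<longleftrightarrow> list_all2 (\<lambda>x d. x \<in> part A d) xs ds"

definition sdegree :: "int list \<Rightarrow> int" where
  "sdegree ds = (\<Sum>d\<leftarrow>ds. d - 1)"

text \<open>Degree \<open>r\<close> with respect to the suspended gradings.\<close>

definition homogeneous_of_degree ::
    "int \<Rightarrow> ('k, 'v) ainf \<Rightarrow> ('k, 'w) ainf \<Rightarrow> ('v list \<Rightarrow> 'w) \<Rightarrow> bool" where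
  "homogeneous_of_degree r A B F \<longleftrightarrow>
     (\<forall>xs ds. xs \<noteq> [] \<and> has_degrees A xs ds \<longrightarrow> F xs \<in> part B (sdegree ds + r + 1))"

definition signed :: "int \<Rightarrow> 'v::ab_group_add \<Rightarrow> 'v" where
  "signed s v = (if even s then v else - v)"

text \<open>
  The coefficient at \<open>xs\<close> of \<open>F\<close> composed with the degree \<open>1\<close> coderivation \<open>Q\<close>, i.e. the sum of
  \<open>F (1\<^sup>\<otimes>\<^sup>i \<otimes> Q\<^sub>j \<otimes> 1\<^sup>\<otimes>\<^sup>k)\<close> over \<open>i + j + k = n\<close>, \<open>j \<ge> 1\<close>, with the Koszul sign.
\<close>

definition comp_coderivation ::
    "('v list \<Rightarrow> 'w::ab_group_add) \<Rightarrow> ('v list \<Rightarrow> 'v) \<Rightarrow> int list \<Rightarrow> 'v list \<Rightarrow> 'w" where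
  "comp_coderivation F Q ds xs =
     (\<Sum>i<length xs. \<Sum>j=1..length xs - i.
        signed (sdegree (take i ds))
          (F (take i xs @ Q (take j (drop i xs)) # drop (i + j) xs)))"

text \<open>
  The coefficient at \<open>xs\<close> of \<open>G\<close> composed with the coalgebra morphism \<open>F\<close>: the sum of
  \<open>G\<^sub>k (F\<^bsub>i\<^sub>1\<^esub> \<otimes> \<dots> \<otimes> F\<^bsub>i\<^sub>k\<^esub>)\<close> over \<open>i\<^sub>1 + \<dots> + i\<^sub>k = n\<close>. The index is the list of nonempty
  blocks into which \<open>xs\<close> is cut; there are no signs because \<open>F\<close> has degree \<open>0\<close>.
\<close>

definition ainf_comp ::
    "('w list \<Rightarrow> 'u::comm_monoid_add) \<Rightarrow> ('v list \<Rightarrow> 'w) \<Rightarrow> 'v list \<Rightarrow> 'u" where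
  "ainf_comp G F xs = (\<Sum>bss | concat bss = xs \<and> [] \<notin> set bss. G (map F bss))"

definition unital_ainf_algebra :: "('k::field, 'v::ab_group_add) ainf \<Rightarrow> bool" where
  "unital_ainf_algebra A \<longleftrightarrow>
     graded_vector_space A \<and>
     multilinear A A (opn A) \<and>
     homogeneous_of_degree 1 A A (opn A) \<and>
     (\<forall>xs ds. xs \<noteq> [] \<and> has_degrees A xs ds \<longrightarrow>
        comp_coderivation (opn A) (opn A) ds xs = 0) \<and>
     unt A \<in> part A 0 \<and>
     (\<forall>d. \<forall>x\<in>part A d. opn A [unt A, x] = x \<and> opn A [x, unt A] = signed d x) \<and>
     (\<forall>xs. set xs \<subseteq> total_space A \<and> length xs \<noteq> 2 \<and> unt A \<in> set xs \<longrightarrow> opn A xs = 0)"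

definition unital_ainf_morphism ::
    "('k::field, 'v::ab_group_add) ainf \<Rightarrow> ('k, 'w::ab_group_add) ainf \<Rightarrow> ('v list \<Rightarrow> 'w) \<Rightarrow> bool" where
  "unital_ainf_morphism A B F \<longleftrightarrow>
     unital_ainf_algebra A \<and> unital_ainf_algebra B \<and>
     multilinear A B F \<and>
     homogeneous_of_degree 0 A B F \<and>
     (\<forall>xs ds. xs \<noteq> [] \<and> has_degrees A xs ds \<longrightarrow>
        ainf_comp (opn B) F xs = comp_coderivation F (opn A) ds xs) \<and>
     F [unt A] = unt B \<and>
     (\<forall>xs. set xs \<subseteq> total_space A \<and> length xs \<ge> 2 \<and> unt A \<in> set xs \<longrightarrow> F xs = 0)"


section \<open>Complexes of functions and one-forms\<close>

text \<open>
  A pair \<open>(f, g)\<close> is the sum of the \<open>0\<close>-form \<open>f\<close> and a \<open>1\<close>-form represented by \<open>g\<close>.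
\<close>

definition two_term_part :: "'f::zero set \<Rightarrow> 'g::zero set \<Rightarrow> int \<Rightarrow> ('f \<times> 'g) set" where
  "two_term_part V0 V1 i =
     (if i = 0 then V0 \<times> {0} else if i = 1 then {0} \<times> V1 else {0})"

text \<open>
  The coefficients \<open>Q\<^sub>1 (s a) = - s (d a)\<close> and \<open>Q\<^sub>2 (s a \<otimes> s b) = (-1)\<^bsup>|a|\<^esup> s (a b)\<close> of a dg
  algebra; \<open>parity a = (-1)\<^bsup>|a|\<^esup> a\<close> for homogeneous \<open>a\<close>.
\<close>

definition parity :: "'f \<times> 'g::ab_group_add \<Rightarrow> 'f \<times> 'g" where
  "parity a = (fst a, - snd a)"

definition dga_opn ::
    "('f::ab_group_add \<times> 'g::ab_group_add \<Rightarrow> 'f \<times> 'g) \<Rightarrow> ('f \<times> 'g \<Rightarrow> 'f \<times> 'g \<Rightarrow> 'f \<times> 'g) \<Rightarrow>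
     ('f \<times> 'g) list \<Rightarrow> 'f \<times> 'g" where
  "dga_opn d m xs =
     (case xs of [a] \<Rightarrow> - d a | [a, b] \<Rightarrow> m (parity a) b | _ \<Rightarrow> 0)"

definition wedge :: "'f::comm_ring \<times> 'f \<Rightarrow> 'f \<times> 'f \<Rightarrow> 'f \<times> 'f" where
  "wedge a b = (fst a * fst b, fst a * snd b + snd a * fst b)"

definition poly_forms :: "('k::field_char_0, 'k poly \<times> 'k poly) ainf" where
  "poly_forms =
     \<lparr> scal = (\<lambda>c a. (smult c (fst a), smult c (snd a))),
       part = two_term_part UNIV UNIV,
       opn = dga_opn (\<lambda>a. (0, pderiv (fst a))) wedge,
       unt = (1, 0) \<rparr>"

text \<open>
  A function on \<open>[0,1]\<close> is represented by its extension by \<open>0\<close> to the real line.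
  Derivatives at the end points are one-sided.
\<close>

definition on_unit_interval :: "(real \<Rightarrow> real) \<Rightarrow> real \<Rightarrow> real" where
  "on_unit_interval f = (\<lambda>x. if x \<in> {0..1} then f x else 0)"

definition smooth_functions :: "(real \<Rightarrow> real) set" where
  "smooth_functions =
     {f. (\<forall>x. x \<notin> {0..1} \<longrightarrow> f x = 0) \<and>
         (\<exists>D. D 0 = f \<and>
            (\<forall>n::nat. \<forall>x\<in>{0..1}. (D n has_real_derivative D (Suc n) x) (at x within {0..1})))}"

definition smooth_forms :: "(real, (real \<Rightarrow> real) \<times> (real \<Rightarrow> real)) ainf" where
  "smooth_forms =
     \<lparr> scal = (\<lambda>c a. (\<lambda>x. c * fst a x, \<lambda>x. c * snd a x)),
       part = two_term_part smooth_functions smooth_functions,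
       opn = dga_opn
         (\<lambda>a. (0, on_unit_interval (\<lambda>x. vector_derivative (fst a) (at x within {0..1})))) wedge,
       unt = (on_unit_interval (\<lambda>x. 1), 0) \<rparr>"


section \<open>Whitney forms\<close>

text \<open>
  \<open>((a, b), c)\<close> stands for \<open>a t + b (1 - t) + c dt\<close>, so that \<open>a\<close> and \<open>b\<close> are the values of the
  function part at \<open>1\<close> and at \<open>0\<close>. The inclusion into forms depends on the model
  of functions on \<open>[0,1]\<close> only through the map \<open>fn\<close> turning a polynomial in \<open>t\<close> into a function.
\<close>

type_synonym 'k whitney = "('k \<times> 'k) \<times> 'k"

definition whitney_inclusion :: "('k::field_char_0 poly \<Rightarrow> 'f) \<Rightarrow> 'k whitney \<Rightarrow> 'f \<times> 'f" where
  "whitney_inclusion fn = (\<lambda>((a, b), c). (fn (smult a [:0, 1:] + smult b [:1, -1:]), fn [:c:]))"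

definition poly_fn :: "'k poly \<Rightarrow> 'k poly" where
  "poly_fn p = p"

definition smooth_fn :: "real poly \<Rightarrow> real \<Rightarrow> real" where
  "smooth_fn p = on_unit_interval (poly p)"

definition whitney_scal :: "'k::field_char_0 \<Rightarrow> 'k whitney \<Rightarrow> 'k whitney" where
  "whitney_scal r = (\<lambda>((a, b), c). ((r * a, r * b), r * c))"

datatype whitney_basis = Unit | T | DT

fun basis_vector :: "whitney_basis \<Rightarrow> 'k::field_char_0 whitney" where
  "basis_vector Unit = ((1, 1), 0)"
| "basis_vector T = ((1, 0), 0)"
| "basis_vector DT = ((0, 0), 1)"

fun coordinate :: "whitney_basis \<Rightarrow> 'k::field_char_0 whitney \<Rightarrow> 'k" where
  "coordinate Unit ((a, b), c) = b"
| "coordinate T ((a, b), c) = a - b"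
| "coordinate DT ((a, b), c) = c"

abbreviation w_one :: "'k::field_char_0 whitney" where "w_one \<equiv> basis_vector Unit"
abbreviation w_t :: "'k::field_char_0 whitney" where "w_t \<equiv> basis_vector T"
abbreviation w_dt :: "'k::field_char_0 whitney" where "w_dt \<equiv> basis_vector DT"

lemma basis_expansion:
  "x = whitney_scal (coordinate Unit x) w_one + whitney_scal (coordinate T x) w_t
     + whitney_scal (coordinate DT x) w_dt"
  by (cases x rule: prod.exhaust; cases "fst x") (auto simp: whitney_scal_def)

definition multilinear_extension ::
    "(whitney_basis list \<Rightarrow> 'k::field_char_0 whitney) \<Rightarrow> 'k whitney list \<Rightarrow> 'k whitney" where
  "multilinear_extension f xs =
     (\<Sum>ws | length ws = length xs.
        whitney_scal (\<Prod>k<length xs. coordinate (ws ! k) (xs ! k)) (f ws))"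

definition whitney_d :: "'k::field_char_0 whitney \<Rightarrow> 'k whitney" where
  "whitney_d = (\<lambda>((a, b), c). ((0, 0), a - b))"

definition cup :: "'k::field_char_0 whitney \<Rightarrow> 'k whitney \<Rightarrow> 'k whitney" where
  "cup = (\<lambda>((a, b), c) ((a', b'), c'). ((a * a', b * b'), b * c' + c * a'))"

text \<open>
  The bilinear product \<open>cup\<close> is determined by the following values on the basis.
\<close>

lemma cup_basis:
  "cup w_one x = x" "cup x w_one = x"
  "cup w_t w_t = w_t" "cup w_t w_dt = 0" "cup w_dt w_t = w_dt" "cup w_dt w_dt = 0"
  by (auto simp: cup_def zero_prod_def split: prod.splits)

lemma cup_bilinear:
  "cup (x + y) z = cup x z + cup y z" "cup z (x + y) = cup z x + cup z y"
  "cup (whitney_scal r x) y = whitney_scal r (cup x y)"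
  "cup x (whitney_scal r y) = whitney_scal r (cup x y)"
  by (auto simp: cup_def whitney_scal_def algebra_simps split: prod.splits)

definition cochains_cup :: "('k::field_char_0, 'k whitney) ainf" where
  "cochains_cup =
     \<lparr> scal = whitney_scal,
       part = two_term_part UNIV UNIV,
       opn = dga_opn whitney_d cup,
       unt = w_one \<rparr>"

definition bernoulli_number :: "nat \<Rightarrow> 'k::field_char_0" where
  "bernoulli_number n = fact n * fps_nth (fps_X / (fps_exp 1 - 1)) n"

text \<open>
  As a power series in \<open>z\<close> with coefficients in \<open>'k[t]\<close>, the generating function
  \<open>z e\<^bsup>tz\<^esup> / (e\<^sup>z - 1)\<close> is the product of \<open>z / (e\<^sup>z - 1)\<close> and \<open>e\<^bsup>tz\<^esup>\<close>.
\<close>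

definition bernoulli_poly :: "nat \<Rightarrow> 'k::field_char_0 poly" where
  "bernoulli_poly n =
     smult (fact n)
       (fps_nth (Abs_fps (\<lambda>m. [:fps_nth (fps_X / (fps_exp 1 - 1)) m:])
               * Abs_fps (\<lambda>m. monom (1 / fact m) m)) n)"

text \<open>
  The polynomial \<open>\<tau> (\<tau> - 1) \<dots> (\<tau> - n + 1) / n!\<close>; the library's \<open>gchoose\<close> is restricted to fields.
\<close>

definition binomial_poly :: "'k::field_char_0 poly \<Rightarrow> nat \<Rightarrow> 'k poly" where
  "binomial_poly \<tau> n = smult (1 / fact n) (\<Prod>i<n. \<tau> - of_nat i)"

definition cinf_coefficient :: "whitney_basis list \<Rightarrow> 'k::field_char_0 whitney" where
  "cinf_coefficient ws =
     (let n = length ws - 1; i = length (takeWhile (\<lambda>w. w = DT) ws) in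
      if ws = [T] then - w_dt
      else if ws = [T, T] then w_t
      else if ws = [T, DT] then whitney_scal (1 / 2) w_dt
      else if ws = [DT, T] then whitney_scal (- (1 / 2)) w_dt
      else if \<exists>w. ws = [Unit, w] then basis_vector (ws ! 1)
      else if ws = [T, Unit] then w_t
      else if ws = [DT, Unit] then - w_dt
      else if n > 1 \<and> ws = replicate i DT @ T # replicate (n - i) DT
        then whitney_scal ((-1) ^ (i + 1) * of_nat (n choose i) * bernoulli_number n / fact n) w_dt
      else 0)"

definition cochains_inf :: "('k::field_char_0, 'k whitney) ainf" where
  "cochains_inf =
     \<lparr> scal = whitney_scal,
       part = two_term_part UNIV UNIV,
       opn = multilinear_extension cinf_coefficient,
       unt = w_one \<rparr>"


section \<open>The morphisms \<open>\<mu>\<close> and \<open>log\<close>\<close>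

text \<open>
  \<open>\<Omega>\<close> is the algebra of forms, \<open>fn\<close> as above. In the vanishing condition the inputs are
  homogeneous and the functions among them are counted; the formulas are those of \<open>\<mu>\<^sub>n\<^sub>+\<^sub>1\<close>.
\<close>

definition is_mu ::
    "('k::field_char_0, 'f::ab_group_add \<times> 'f) ainf \<Rightarrow> ('k poly \<Rightarrow> 'f) \<Rightarrow>
     ('k whitney list \<Rightarrow> 'f \<times> 'f) \<Rightarrow> bool" where
  "is_mu \<Omega> fn \<mu> \<longleftrightarrow>
     unital_ainf_morphism cochains_inf \<Omega> \<mu> \<and>
     (\<forall>x. \<mu> [x] = whitney_inclusion fn x) \<and>
     (\<forall>xs. length xs \<ge> 2 \<and>
        set xs \<subseteq> part cochains_inf 0 \<union> part (cochains_inf :: ('k, 'k whitney) ainf) 1 \<and>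
        length (filter (\<lambda>x. x \<in> part cochains_inf 0) xs) \<noteq> 1 \<longrightarrow> \<mu> xs = 0) \<and>
     (\<forall>n\<ge>1. \<forall>i\<le>n.
        \<mu> (replicate i w_dt @ w_t # replicate (n - i) w_dt) =
          (fn (smult ((-1) ^ i * of_nat (n choose i) / fact (n + 1))
                (bernoulli_poly (n + 1) - [:bernoulli_number (n + 1):])), 0))"

text \<open>
  A morphism with these properties is an isomorphism, as its linear part is the identity.
\<close>

definition is_log :: "('k::field_char_0 whitney list \<Rightarrow> 'k whitney) \<Rightarrow> bool" where
  "is_log lg \<longleftrightarrow>
     unital_ainf_morphism cochains_cup cochains_inf lg \<and>
     (\<forall>x. lg [x] = x) \<and>
     (\<forall>xs. length xs > 1 \<and> (\<exists>x\<in>set xs. x \<in> part (cochains_cup :: ('k, 'k whitney) ainf) 0) \<longrightarrow>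
        lg xs = 0) \<and>
     (\<forall>n\<ge>1. lg (replicate n w_dt) = whitney_scal ((-1) ^ (n + 1) / of_nat n) w_dt)"

end

theory Submission
  imports Defs
begin

text \<open>
  Write \<open>c\<^sub>n = (-1)\<^bsup>n+1\<^esup> / n\<close> for the coefficients of \<open>log (1 + z)\<close>, and \<open>dt\<^sup>i t dt\<^sup>j\<close> for the word
  with \<open>i\<close> letters \<open>dt\<close> before \<open>t\<close> and \<open>j\<close> after it.

  A composite of unital A-infinity morphisms is again one (\<open>unital_ainf_morphism_comp\<close>). In the
  language of coalgebras this is immediate; for Taylor coefficients it rests on two ways of
  regrouping sums over the ways to cut a list into blocks (\<open>sum_cuts_cuts\<close>, and
  \<open>sum_factors_of_cuts\<close> with \<open>sum_factors_of_blocks\<close>).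

  The values of \<open>\<gamma>\<close> at words in \<open>dt\<close> alone are those of \<open>log\<close>, because \<open>\<mu>\<close> kills two or more
  one-forms. For the word \<open>dt\<^sup>i t dt\<^sup>j\<close> there is a shortcut around the generating function of the
  Bernoulli polynomials. Since \<open>log\<close> kills every block of two or more letters containing \<open>t\<close>, the value is a linear
  combination of values \<open>\<mu> (dt\<^sup>p t dt\<^sup>q)\<close>, which are polynomials vanishing at \<open>t = 0\<close>, as
  \<open>B\<^sub>n(0) = B\<^sub>n\<close>; so it is a polynomial \<open>P\<^sub>i\<^sub>j\<close> with \<open>P\<^sub>i\<^sub>j(0) = 0\<close> (\<open>gamma_t_word\<close>). Moreover
  \<open>\<gamma>\<close> is an A-infinity morphism between dg algebras, and its relation at \<open>dt\<^sup>i t dt\<^sup>j\<close>, to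
  which the source contributes only \<open>d t = dt\<close> and \<open>dt \<union> t = dt\<close>, reads
    \<open>P\<^sub>i\<^sub>j' = c\<^bsub>i+j+1\<^esub> + [i \<ge> 1] c\<^bsub>i+j\<^esub> - (\<Sum>a=1..i. c\<^sub>a P\<^bsub>i-a,j\<^esub>) + (\<Sum>b=1..j. c\<^sub>b P\<^bsub>i,j-b\<^esub>)\<close>
  (\<open>gamma_recursion\<close>). Together with the initial value this determines all \<open>P\<^sub>i\<^sub>j\<close> by induction
  on \<open>i + j\<close>. The binomial sums vanish at \<open>0\<close> and satisfy the same equation
  (\<open>pderiv_binomial_sum\<close>): the derivative of \<open>(1 + z)\<^sup>\<tau>\<close> in \<open>\<tau>\<close> is \<open>log (1 + z) (1 + z)\<^sup>\<tau>\<close>, and the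
  terms in which the inner sum is complete are evaluated by Vandermonde's identity, which also
  produces the two constants.

  Finally a unital morphism out of \<open>C\<^sub>\<union>\<close> is determined by its linear part and the values listed in
  the theorem (\<open>morphism_determined\<close>): words containing \<open>1\<close> are covered by unitality, and a word with
  two or more letters \<open>t\<close> has its value in negative degree. Everything is done for a model of
  functions on the interval containing the polynomials (\<open>form_model\<close>), of which polynomial and
  smooth forms are the two instances.
\<close>

section \<open>Cutting a list into blocks\<close>

definition cuts :: "'a list \<Rightarrow> 'a list list set" where
  "cuts xs = {bss. concat bss = xs \<and> [] \<notin> set bss}"

text \<open>
  These triples index the terms of a map composed with a coderivation, just as \<open>cuts\<close> indexes the
  terms of a map composed with a coalgebra morphism.
\<close>

definition factors :: "'a list \<Rightarrow> ('a list \<times> 'a list \<times> 'a list) set" where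
  "factors xs = {(us, ys, vs). us @ ys @ vs = xs \<and> ys \<noteq> []}"

text \<open>
  A cut of \<open>A @ z # C\<close> has exactly one block containing the entry \<open>z\<close>. The blocks before it,
  together with the beginning of the block of \<open>z\<close>, form a left cut of \<open>A\<close>; a right cut of \<open>C\<close> is the
  mirror image. The distinguished piece may be empty.
\<close>

definition left_cuts :: "'a list \<Rightarrow> ('a list list \<times> 'a list) set" where
  "left_cuts xs = {(us, a). concat us @ a = xs \<and> [] \<notin> set us}"

definition right_cuts :: "'a list \<Rightarrow> ('a list \<times> 'a list list) set" where
  "right_cuts xs = {(c, vs). c @ concat vs = xs \<and> [] \<notin> set vs}"

lemma length_le_concat: "[] \<notin> set bss \<Longrightarrow> length bss \<le> length (concat bss)"
proof (induction bss)
  case (Cons b bss)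
  then have "length b \<ge> 1" by (cases b) auto
  with Cons show ?case by auto
qed auto

lemma finite_cuts: "finite (cuts xs)"
proof -
  let ?A = "{b. set b \<subseteq> set xs \<and> length b \<le> length xs}"
  have "finite ?A" by (intro finite_lists_length_le) auto
  then have "finite {bss. set bss \<subseteq> ?A \<and> length bss \<le> length xs}"
    by (rule finite_lists_length_le)
  moreover have "cuts xs \<subseteq> {bss. set bss \<subseteq> ?A \<and> length bss \<le> length xs}"
  proof
    fix bss assume "bss \<in> cuts xs"
    then have *: "concat bss = xs" "[] \<notin> set bss" by (auto simp: cuts_def)
    have "length b \<le> length (concat bss)" if "b \<in> set bss" for b
      using that by (induction bss) auto
    with * length_le_concat[OF *(2)] show "bss \<in> {bss. set bss \<subseteq> ?A \<and> length bss \<le> length xs}"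
      by auto
  qed
  ultimately show ?thesis by (rule rev_finite_subset)
qed

lemma finite_factors: "finite (factors xs)"
proof -
  let ?A = "{b. set b \<subseteq> set xs \<and> length b \<le> length xs}"
  have "finite ?A" by (intro finite_lists_length_le) auto
  then have "finite (?A \<times> ?A \<times> ?A)" by auto
  moreover have "factors xs \<subseteq> ?A \<times> ?A \<times> ?A" by (auto simp: factors_def)
  ultimately show ?thesis by (rule rev_finite_subset)
qed

lemma ainf_comp_cuts: "ainf_comp G F xs = (\<Sum>bss\<in>cuts xs. G (map F bss))"
  by (simp add: ainf_comp_def cuts_def)

lemma cuts_singleton: "cuts [x] = {[[x]]}"
proof -
  have "bss = [[x]]" if "concat bss = [x]" "[] \<notin> set bss" for bss
    using that length_le_concat[OF that(2)] by (cases bss; cases "tl bss") auto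
  then show ?thesis by (auto simp: cuts_def)
qed

lemma cuts_ne: "bss \<in> cuts xs \<Longrightarrow> xs \<noteq> [] \<Longrightarrow> bss \<noteq> []"
  by (auto simp: cuts_def)

text \<open>
  The lengths of the blocks determine a cut of a given list, and \<open>f\<close> preserves them. Hence the cuts of a
  list correspond to those of its image; \<open>f\<close> will be \<open>fst\<close>, forgetting the degrees attached to vectors.
\<close>

lemma map_map_concat_inj:
  "concat c = concat c' \<Longrightarrow> map (map f) c = map (map f) c' \<Longrightarrow> c = c'"
proof (induction c arbitrary: c')
  case (Cons b c)
  then obtain b' d where c': "c' = b' # d" by (cases c') auto
  with Cons.prems have "length b = length b'" by (auto dest: map_eq_imp_length_eq)
  with Cons c' show ?case by auto
qed auto

lemma lift_cut:
  "concat bss = map f zs \<Longrightarrow> \<exists>css. concat css = zs \<and> map (map f) css = bss"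
proof (induction bss arbitrary: zs)
  case (Cons b bss)
  then obtain z1 z2 where "zs = z1 @ z2" "b = map f z1" "concat bss = map f z2"
    by (auto simp: append_eq_map_conv)
  moreover from Cons.IH[OF this(3)] obtain css where "concat css = z2" "map (map f) css = bss"
    by blast
  ultimately show ?case by (intro exI[of _ "z1 # css"]) auto
qed auto

lemma bij_betw_cuts_map: "bij_betw (map (map f)) (cuts zs) (cuts (map f zs))"
proof (rule bij_betw_imageI)
  show "inj_on (map (map f)) (cuts zs)"
    by (rule inj_onI, rule map_map_concat_inj) (auto simp: cuts_def)
  show "map (map f) ` cuts zs = cuts (map f zs)"
  proof (intro equalityI subsetI)
    fix bss assume "bss \<in> cuts (map f zs)"
    then have *: "concat bss = map f zs" "[] \<notin> set bss" by (auto simp: cuts_def)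
    from lift_cut[OF *(1)] obtain css where "concat css = zs" "map (map f) css = bss" by blast
    with * show "bss \<in> map (map f) ` cuts zs"
      by (intro image_eqI[of _ _ css]) (auto simp: cuts_def)
  qed (auto simp: cuts_def map_concat)
qed

lemma sum_cuts_map: "(\<Sum>bss\<in>cuts (map f zs). h bss) = (\<Sum>bss\<in>cuts zs. h (map (map f) bss))"
  using sum.reindex_bij_betw[OF bij_betw_cuts_map] by metis

text \<open>
  The condition on \<open>A\<close>, the list before \<open>z\<close>, locates the distinguished occurrence; without it an equal
  entry elsewhere could play its role.
\<close>

lemma cut_at_entry_inj:
  assumes "concat us @ a = concat us' @ a'"
    and "us @ (a @ z # c) # vs = us' @ (a' @ z # c') # vs'"
  shows "us = us' \<and> a = a' \<and> c = c' \<and> vs = vs'"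
  using assms
proof (induction us arbitrary: us')
  case Nil
  show ?case
  proof (cases us')
    case (Cons b bs)
    with Nil have "a = (a @ z # c) @ concat bs @ a'" by auto
    then have "length a = length ((a @ z # c) @ concat bs @ a')" by (rule arg_cong)
    then show ?thesis by simp
  qed (use Nil in auto)
next
  case (Cons b us)
  show ?case
  proof (cases us')
    case Nil
    with Cons.prems have "(a' @ z # c') @ concat us @ a = a'" by auto
    then have "length ((a' @ z # c') @ concat us @ a) = length a'" by (rule arg_cong)
    then show ?thesis by simp
  next
    case (Cons b' bs)
    with Cons.prems Cons.IH[of bs] show ?thesis by auto
  qed
qed

lemma cut_at_entry_ex:
  assumes "concat bss = A @ z # C"
  shows "\<exists>us a c vs. bss = us @ (a @ z # c) # vs \<and> concat us @ a = A \<and> c @ concat vs = C"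
  using assms
proof (induction bss arbitrary: A)
  case (Cons b bss)
  then have "b @ concat bss = A @ z # C" by simp
  then consider c where "b = A @ z # c" "c @ concat bss = C"
    | A' where "A = b @ A'" "concat bss = A' @ z # C"
    by (fastforce simp: append_eq_append_conv2 append_eq_Cons_conv Cons_eq_append_conv)
  then show ?case
  proof cases
    case 1
    then show ?thesis by (intro exI[of _ "[]"] exI[of _ A] exI[of _ c] exI[of _ bss]) auto
  next
    case 2
    from Cons.IH[OF 2(2)] obtain us a c vs where
      "bss = us @ (a @ z # c) # vs" "concat us @ a = A'" "c @ concat vs = C" by blast
    with 2 show ?thesis by (intro exI[of _ "b # us"] exI[of _ a] exI[of _ c] exI[of _ vs]) auto
  qed
qed auto

lemma sum_cuts_at_entry:
  "(\<Sum>bss\<in>cuts (A @ z # C). h bss) =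
   (\<Sum>((us, a), (c, vs))\<in>left_cuts A \<times> right_cuts C. h (us @ (a @ z # c) # vs))"
proof -
  have "bij_betw (\<lambda>((us, a), (c, vs)). us @ (a @ z # c) # vs) (left_cuts A \<times> right_cuts C)
          (cuts (A @ z # C))"
    (is "bij_betw ?f ?L _")
  proof (rule bij_betw_imageI)
    show "inj_on ?f ?L"
    proof (rule inj_onI)
      fix p q assume "p \<in> ?L" "q \<in> ?L" and eq: "?f p = ?f q"
      moreover obtain us a c vs us' a' c' vs' where
        "p = ((us, a), (c, vs))" "q = ((us', a'), (c', vs'))"
        by (metis prod.exhaust)
      ultimately show "p = q"
        using cut_at_entry_inj[of us a us' a' z c vs c' vs'] by (auto simp: left_cuts_def)
    qed
    show "?f ` ?L = cuts (A @ z # C)"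
    proof (intro equalityI subsetI)
      fix bss assume "bss \<in> cuts (A @ z # C)"
      then have *: "concat bss = A @ z # C" "[] \<notin> set bss" by (auto simp: cuts_def)
      from cut_at_entry_ex[OF *(1)] obtain us a c vs where
        "bss = us @ (a @ z # c) # vs" "concat us @ a = A" "c @ concat vs = C" by blast
      with *(2) show "bss \<in> ?f ` ?L"
        by (intro image_eqI[of _ _ "((us, a), (c, vs))"]) (auto simp: left_cuts_def right_cuts_def)
    qed (auto simp: cuts_def left_cuts_def right_cuts_def)
  qed
  from sum.reindex_bij_betw[OF this, of h] show ?thesis
    by (simp add: case_prod_unfold)
qed

text \<open>
  Lists of cuts, the \<open>k\<close>-th one being a cut of the \<open>k\<close>-th list in \<open>dss\<close>.
\<close>

definition refinements :: "'a list list \<Rightarrow> 'a list list list set" where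
  "refinements dss = {css. map concat css = dss \<and> [] \<notin> set (concat css)}"

lemma refinements_Nil: "refinements [] = {[]}"
  by (auto simp: refinements_def)

lemma refinements_Cons:
  "refinements (d # dss) = (\<lambda>(c, css). c # css) ` (cuts d \<times> refinements dss)"
  by (auto simp: refinements_def cuts_def map_eq_Cons_conv image_iff)

lemma finite_refinements: "finite (refinements dss)"
  by (induction dss) (auto simp: refinements_Nil refinements_Cons finite_cuts)

lemma concat_concat: "concat (concat css) = concat (map concat css)"
  by (induction css) auto

lemma cuts_of_cuts_iff:
  "bss \<in> cuts xs \<and> css \<in> cuts bss \<longleftrightarrow>
   bss = concat css \<and> concat (concat css) = xs \<and> [] \<notin> set (concat css) \<and> [] \<notin> set css"
  unfolding cuts_def by blast

lemma refinements_of_cuts_iff: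
  "dss \<in> cuts xs \<and> css \<in> refinements dss \<longleftrightarrow>
   dss = map concat css \<and> concat (concat css) = xs \<and> [] \<notin> set (concat css) \<and> [] \<notin> set css"
proof -
  have "[] \<notin> set (map concat css) \<longleftrightarrow> [] \<notin> set css" if "[] \<notin> set (concat css)"
    using that by (induction css) (auto, (metis neq_Nil_conv list.set_intros(1))+)
  then show ?thesis unfolding cuts_def refinements_def concat_concat by blast
qed

text \<open>
  Cutting a list and then grouping the blocks amounts to cutting it coarsely and then refining each
  block: both are lists of lists of blocks. This is the associativity of composition.
\<close>

lemma sum_cuts_cuts:
  "(\<Sum>bss\<in>cuts xs. \<Sum>css\<in>cuts bss. h css) = (\<Sum>dss\<in>cuts xs. \<Sum>css\<in>refinements dss. h css)"
proof -
  let ?K = "{css. concat (concat css) = xs \<and> [] \<notin> set (concat css) \<and> [] \<notin> set css}"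
  have 1: "Sigma (cuts xs) cuts = (\<lambda>css. (concat css, css)) ` ?K"
    using cuts_of_cuts_iff[of _ xs] by blast
  have 2: "Sigma (cuts xs) refinements = (\<lambda>css. (map concat css, css)) ` ?K"
    using refinements_of_cuts_iff[of _ xs] by blast
  have "(\<Sum>bss\<in>cuts xs. \<Sum>css\<in>cuts bss. h css) = (\<Sum>(bss, css)\<in>Sigma (cuts xs) cuts. h css)"
    by (rule sum.Sigma) (auto intro: finite_cuts)
  also have "\<dots> = (\<Sum>css\<in>?K. h css)"
    unfolding 1 by (subst sum.reindex) (auto intro: inj_onI simp del: set_concat)
  also have "\<dots> = (\<Sum>(dss, css)\<in>Sigma (cuts xs) refinements. h css)"
    unfolding 2 by (subst sum.reindex) (auto intro: inj_onI simp del: set_concat)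
  also have "\<dots> = (\<Sum>dss\<in>cuts xs. \<Sum>css\<in>refinements dss. h css)"
    by (rule sum.Sigma[symmetric]) (auto intro: finite_cuts finite_refinements)
  finally show ?thesis .
qed

lemma left_cuts_eq: "left_cuts xs = (\<Union>k\<le>length xs. cuts (take k xs) \<times> {drop k xs})"
proof -
  have "(us, a) \<in> (\<Union>k\<le>length xs. cuts (take k xs) \<times> {drop k xs})" if "(us, a) \<in> left_cuts xs" for us a
    using that by (intro UN_I[of "length (concat us)"]) (auto simp: left_cuts_def cuts_def)
  then show ?thesis by (auto simp: left_cuts_def cuts_def)
qed

lemma right_cuts_eq: "right_cuts xs = (\<Union>k\<le>length xs. {take k xs} \<times> cuts (drop k xs))"
proof -
  have "(c, vs) \<in> (\<Union>k\<le>length xs. {take k xs} \<times> cuts (drop k xs))" if "(c, vs) \<in> right_cuts xs" for c vs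
    using that by (intro UN_I[of "length c"]) (auto simp: right_cuts_def cuts_def)
  then show ?thesis by (auto simp: right_cuts_def cuts_def)
qed

lemma finite_left_cuts: "finite (left_cuts xs)"
  by (auto simp: left_cuts_eq finite_cuts)

lemma finite_right_cuts: "finite (right_cuts xs)"
  by (auto simp: right_cuts_eq finite_cuts)

lemma blocks_of_Nil: "concat bs = [] \<Longrightarrow> [] \<notin> set bs \<Longrightarrow> bs = []"
  by (cases bs) auto

text \<open>
  Choosing a run of consecutive blocks in a cut is the same as choosing the segment that they cover
  and cutting the three parts separately.
\<close>

lemma sum_factors_of_cuts:
  "(\<Sum>bss\<in>cuts xs. \<Sum>(us, ys, vs)\<in>factors bss. h us ys vs) =
   (\<Sum>(p, m, q)\<in>factors xs. \<Sum>us\<in>cuts p. \<Sum>vs\<in>cuts q. \<Sum>ys\<in>cuts m. h us ys vs)"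
proof -
  let ?K = "{(us, ys, vs). concat us @ concat ys @ concat vs = xs \<and> ys \<noteq> [] \<and>
              [] \<notin> set us \<and> [] \<notin> set ys \<and> [] \<notin> set vs}"
  let ?T = "\<lambda>(p, m, q). cuts p \<times> cuts q \<times> cuts m"
  have 1: "Sigma (cuts xs) factors = (\<lambda>(us, ys, vs). (us @ ys @ vs, (us, ys, vs))) ` ?K"
    by (force simp: cuts_def factors_def)
  have 2: "Sigma (factors xs) ?T =
      (\<lambda>(us, ys, vs). ((concat us, concat ys, concat vs), (us, vs, ys))) ` ?K"
  proof (intro equalityI subsetI)
    fix x assume "x \<in> Sigma (factors xs) ?T"
    then show "x \<in> (\<lambda>(us, ys, vs). ((concat us, concat ys, concat vs), (us, vs, ys))) ` ?K"
      by (force simp: cuts_def factors_def simp del: concat_eq_Nil_conv)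
  next
    fix x assume "x \<in> (\<lambda>(us, ys, vs). ((concat us, concat ys, concat vs), (us, vs, ys))) ` ?K"
    then obtain us ys vs where x: "x = ((concat us, concat ys, concat vs), (us, vs, ys))"
      and k: "(us, ys, vs) \<in> ?K" by auto
    then have "concat ys \<noteq> []" using blocks_of_Nil[of ys] by (auto simp del: concat_eq_Nil_conv)
    with x k show "x \<in> Sigma (factors xs) ?T"
      by (auto simp: cuts_def factors_def simp del: concat_eq_Nil_conv)
  qed
  have "(\<Sum>bss\<in>cuts xs. \<Sum>(us, ys, vs)\<in>factors bss. h us ys vs) =
      (\<Sum>(bss, us, ys, vs)\<in>Sigma (cuts xs) factors. h us ys vs)"
    by (rule sum.Sigma) (auto intro: finite_cuts finite_factors)
  also have "\<dots> = (\<Sum>(us, ys, vs)\<in>?K. h us ys vs)"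
    unfolding 1 by (subst sum.reindex) (auto intro!: inj_onI sum.cong)
  also have "\<dots> = (\<Sum>(_, us, vs, ys)\<in>Sigma (factors xs) ?T. h us ys vs)"
    unfolding 2 by (subst sum.reindex) (auto intro!: inj_onI sum.cong)
  also have "\<dots> = (\<Sum>x\<in>factors xs. \<Sum>(us, vs, ys)\<in>?T x. h us ys vs)"
    by (rule sum.Sigma[symmetric]) (auto intro: finite_cuts finite_factors)
  also have "\<dots> = (\<Sum>(p, m, q)\<in>factors xs. \<Sum>us\<in>cuts p. \<Sum>vs\<in>cuts q. \<Sum>ys\<in>cuts m. h us ys vs)"
    by (simp add: case_prod_unfold sum.cartesian_product)
  finally show ?thesis .
qed

text \<open>
  A segment \<open>b\<close> inside a block, with the other entries of the list cut into blocks, can be chosen in two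
  orders: first the block \<open>m\<close> and then \<open>b\<close> inside it, or first \<open>b\<close> and then the rest of the cut. The first
  order arises from a coderivation applied before the inner morphism at one block, the second from
  the coderivation applied before the composite.
\<close>

lemma sum_factors_of_blocks:
  "(\<Sum>(p, m, q)\<in>factors xs. \<Sum>us\<in>cuts p. \<Sum>vs\<in>cuts q. \<Sum>(a, b, c)\<in>factors m. h us a b c vs) =
   (\<Sum>(A, b, C)\<in>factors xs. \<Sum>((us, a), (c, vs))\<in>left_cuts A \<times> right_cuts C. h us a b c vs)"
proof -
  let ?K = "{(us, a, b, c, vs). concat us @ a @ b @ c @ concat vs = xs \<and> b \<noteq> [] \<and>
              [] \<notin> set us \<and> [] \<notin> set vs}"
  let ?S = "\<lambda>(p, m, q). cuts p \<times> cuts q \<times> factors m"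
  let ?T = "\<lambda>(A, b, C). left_cuts A \<times> right_cuts C"
  have 1: "Sigma (factors xs) ?S =
      (\<lambda>(us, a, b, c, vs). ((concat us, a @ b @ c, concat vs), (us, vs, (a, b, c)))) ` ?K"
    by (force simp: cuts_def factors_def simp del: concat_eq_Nil_conv)
  have 2: "Sigma (factors xs) ?T =
      (\<lambda>(us, a, b, c, vs). ((concat us @ a, b, c @ concat vs), ((us, a), (c, vs)))) ` ?K"
    by (force simp: left_cuts_def right_cuts_def factors_def simp del: concat_eq_Nil_conv)
  have "(\<Sum>(p, m, q)\<in>factors xs. \<Sum>us\<in>cuts p. \<Sum>vs\<in>cuts q. \<Sum>(a, b, c)\<in>factors m. h us a b c vs) =
      (\<Sum>x\<in>factors xs. \<Sum>(us, vs, a, b, c)\<in>?S x. h us a b c vs)"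
    by (simp add: case_prod_unfold sum.cartesian_product)
  also have "\<dots> = (\<Sum>(_, us, vs, a, b, c)\<in>Sigma (factors xs) ?S. h us a b c vs)"
    by (rule sum.Sigma) (auto intro: finite_cuts finite_factors)
  also have "\<dots> = (\<Sum>(us, a, b, c, vs)\<in>?K. h us a b c vs)"
    unfolding 1 by (subst sum.reindex) (auto intro!: inj_onI sum.cong)
  also have "\<dots> = (\<Sum>((_, b, _), (us, a), (c, vs))\<in>Sigma (factors xs) ?T. h us a b c vs)"
    unfolding 2 by (subst sum.reindex) (auto intro!: inj_onI sum.cong)
  also have "\<dots> = (\<Sum>x\<in>factors xs. \<Sum>((us, a), (c, vs))\<in>?T x. h us a (fst (snd x)) c vs)"
    by (subst sum.Sigma) (auto intro: finite_left_cuts finite_right_cuts finite_factors intro!: sum.cong)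
  finally show ?thesis by (simp add: case_prod_unfold)
qed

text \<open>
  The arguments and their degrees are images of one common list \<open>bs\<close>, so that they are cut
  simultaneously; \<open>bs\<close> is a list of pairs (vector, degree) or a list of blocks of such pairs.
\<close>

lemma comp_coderivation_factors:
  "comp_coderivation F Q (map g bs) (map f bs) =
   (\<Sum>(us, ys, vs)\<in>factors bs. signed (sdegree (map g us)) (F (map f us @ Q (map f ys) # map f vs)))"
proof -
  let ?n = "length bs"
  let ?I = "Sigma {..<?n} (\<lambda>i. {1..?n - i})"
  let ?j = "\<lambda>(i, j). (take i bs, take j (drop i bs), drop (i + j) bs)"
  have split: "take i bs @ take j (drop i bs) @ drop (i + j) bs = bs" for i j
    by (metis append_take_drop_id drop_drop add.commute)
  have "?j ` ?I = factors bs"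
  proof (intro equalityI subsetI)
    fix x assume "x \<in> factors bs"
    then obtain us ys vs where "x = (us, ys, vs)" "bs = us @ ys @ vs" "ys \<noteq> []"
      by (auto simp: factors_def)
    then show "x \<in> ?j ` ?I"
      by (intro image_eqI[of _ _ "(length us, length ys)"]) (auto simp: Suc_le_eq)
  qed (use split in \<open>auto simp: factors_def\<close>)
  moreover have "inj_on ?j ?I"
  proof (rule inj_onI, clarify)
    fix i j i' j'
    assume *: "i < ?n" "j \<in> {1..?n - i}" "i' < ?n" "j' \<in> {1..?n - i'}"
      and "take i bs = take i' bs" "take j (drop i bs) = take j' (drop i' bs)"
    then have "length (take i bs) = length (take i' bs)"
      "length (take j (drop i bs)) = length (take j' (drop i' bs))" by simp_all
    with * show "i = i' \<and> j = j'" by auto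
  qed
  ultimately have bij: "bij_betw ?j ?I (factors bs)" by (simp add: bij_betw_def)
  have "comp_coderivation F Q (map g bs) (map f bs) = (\<Sum>(i, j)\<in>?I.
      signed (sdegree (take i (map g bs)))
        (F (take i (map f bs) @ Q (take j (drop i (map f bs))) # drop (i + j) (map f bs))))"
    unfolding comp_coderivation_def length_map by (rule sum.Sigma) auto
  also have "\<dots> = (\<Sum>(us, ys, vs)\<in>factors bs.
      signed (sdegree (map g us)) (F (map f us @ Q (map f ys) # map f vs)))"
    by (subst sum.reindex_bij_betw[OF bij, symmetric])
      (auto intro!: sum.cong simp: take_map drop_map)
  finally show ?thesis .
qed

lemma set_block: "b \<in> set bs \<Longrightarrow> set b \<subseteq> set (concat bs)"
  by auto

section \<open>Multilinear maps on graded vector spaces\<close>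

lemma signed_0: "signed s 0 = 0"
  by (simp add: signed_def)

lemma signed_sum: "signed s (\<Sum>i\<in>I. f i) = (\<Sum>i\<in>I. signed s (f i))"
  by (simp add: signed_def sum_negf)

lemma signed_signed: "signed s (signed t v) = signed (s + t) v"
  by (auto simp: signed_def)

lemma sdegree_append: "sdegree (ds @ es) = sdegree ds + sdegree es"
  by (simp add: sdegree_def)

lemma part_total_space:
  assumes "graded_vector_space A" "x \<in> part A d"
  shows "x \<in> total_space A"
proof -
  interpret vector_space "scal A" using assms by (simp add: graded_vector_space_def)
  show ?thesis using assms(2) unfolding total_space_def by (blast intro: span_base)
qed

lemma total_space_0: "graded_vector_space A \<Longrightarrow> 0 \<in> total_space A"
proof -
  assume "graded_vector_space A"
  then interpret vector_space "scal A" by (simp add: graded_vector_space_def)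
  show ?thesis unfolding total_space_def by (rule span_zero)
qed

lemma total_space_add:
  "graded_vector_space A \<Longrightarrow> x \<in> total_space A \<Longrightarrow> y \<in> total_space A \<Longrightarrow> x + y \<in> total_space A"
proof -
  assume "graded_vector_space A" and *: "x \<in> total_space A" "y \<in> total_space A"
  then interpret vector_space "scal A" by (simp add: graded_vector_space_def)
  show ?thesis using * unfolding total_space_def by (rule span_add)
qed

lemma total_space_scal:
  "graded_vector_space A \<Longrightarrow> x \<in> total_space A \<Longrightarrow> scal A c x \<in> total_space A"
proof -
  assume "graded_vector_space A" and *: "x \<in> total_space A"
  then interpret vector_space "scal A" by (simp add: graded_vector_space_def)
  show ?thesis using * unfolding total_space_def by (rule span_scale)
qed

lemma total_space_minus:
  "graded_vector_space A \<Longrightarrow> x \<in> total_space A \<Longrightarrow> - x \<in> total_space A"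
proof -
  assume "graded_vector_space A" and *: "x \<in> total_space A"
  then interpret vector_space "scal A" by (simp add: graded_vector_space_def)
  show ?thesis using * unfolding total_space_def by (rule span_neg)
qed

lemma total_space_sum:
  "graded_vector_space A \<Longrightarrow> (\<And>i. i \<in> I \<Longrightarrow> f i \<in> total_space A) \<Longrightarrow> (\<Sum>i\<in>I. f i) \<in> total_space A"
proof -
  assume "graded_vector_space A" and *: "\<And>i. i \<in> I \<Longrightarrow> f i \<in> total_space A"
  then interpret vector_space "scal A" by (simp add: graded_vector_space_def)
  show ?thesis using * unfolding total_space_def by (rule span_sum)
qed

lemma total_space_signed:
  "graded_vector_space A \<Longrightarrow> x \<in> total_space A \<Longrightarrow> signed s x \<in> total_space A"
  by (auto simp: signed_def total_space_minus)

lemma part_sum: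
  assumes "graded_vector_space A" "\<And>i. i \<in> I \<Longrightarrow> f i \<in> part A d"
  shows "(\<Sum>i\<in>I. f i) \<in> part A d"
proof -
  interpret vector_space "scal A" using assms by (simp add: graded_vector_space_def)
  have "subspace (part A d)" using assms by (simp add: graded_vector_space_def)
  then show ?thesis using assms(2) by (rule subspace_sum)
qed

lemma scal_sum:
  assumes "graded_vector_space A"
  shows "scal A c (\<Sum>i\<in>I. f i) = (\<Sum>i\<in>I. scal A c (f i))"
proof -
  interpret vector_space "scal A" using assms by (simp add: graded_vector_space_def)
  show ?thesis by (rule scale_sum_right)
qed

lemma multilinear_add:
  "\<lbrakk>multilinear A B F; set us \<subseteq> total_space A; set vs \<subseteq> total_space A;
    x \<in> total_space A; y \<in> total_space A\<rbrakk> \<Longrightarrow>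
   F (us @ (x + y) # vs) = F (us @ x # vs) + F (us @ y # vs)"
  unfolding multilinear_def by blast

lemma multilinear_scal:
  "\<lbrakk>multilinear A B F; set us \<subseteq> total_space A; set vs \<subseteq> total_space A; x \<in> total_space A\<rbrakk> \<Longrightarrow>
   F (us @ scal A c x # vs) = scal B c (F (us @ x # vs))"
  unfolding multilinear_def by blast

lemma multilinear_0:
  assumes "graded_vector_space A" "multilinear A B F"
    "set us \<subseteq> total_space A" "set vs \<subseteq> total_space A"
  shows "F (us @ 0 # vs) = 0"
  using multilinear_add[OF assms(2-4) total_space_0 total_space_0] assms(1) by simp

lemma multilinear_sum:
  assumes "graded_vector_space A" "multilinear A B F"
    "set us \<subseteq> total_space A" "set vs \<subseteq> total_space A" "\<And>i. i \<in> I \<Longrightarrow> f i \<in> total_space A"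
  shows "F (us @ (\<Sum>i\<in>I. f i) # vs) = (\<Sum>i\<in>I. F (us @ f i # vs))"
  using assms(5)
proof (induction I rule: infinite_finite_induct)
  case (insert i I)
  then show ?case
    using multilinear_add[OF assms(2-4)] total_space_sum[OF assms(1), of I f] by simp
qed (use multilinear_0[OF assms(1-4)] in auto)

lemma multilinear_signed:
  assumes "graded_vector_space A" "multilinear A B F"
    "set us \<subseteq> total_space A" "set vs \<subseteq> total_space A" "x \<in> total_space A"
  shows "F (us @ signed s x # vs) = signed s (F (us @ x # vs))"
proof -
  have "F (us @ (x + - x) # vs) = F (us @ x # vs) + F (us @ (- x) # vs)"
    using assms by (intro multilinear_add) (auto intro: total_space_minus)
  then have "F (us @ (- x) # vs) = - F (us @ x # vs)"
    using multilinear_0[OF assms(1-4)] by (simp add: minus_unique)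
  then show ?thesis by (simp add: signed_def)
qed

text \<open>
  When each argument is a composite coefficient, hence a sum over cuts, expanding all arguments leaves a
  sum over a choice of one cut for each argument, that is, over refinements.
\<close>

lemma multilinear_sum_refinements:
  assumes "graded_vector_space A" "multilinear A B F"
    "set us \<subseteq> total_space A" "\<And>d b. d \<in> set ds \<Longrightarrow> b \<in> cuts d \<Longrightarrow> g b \<in> total_space A"
  shows "F (us @ map (\<lambda>d. \<Sum>b\<in>cuts d. g b) ds) = (\<Sum>bs\<in>refinements ds. F (us @ map g bs))"
  using assms(3,4)
proof (induction ds arbitrary: us)
  case Nil
  then show ?case by (simp add: refinements_Nil)
next
  case (Cons d ds)
  have "F (us @ map (\<lambda>d. \<Sum>b\<in>cuts d. g b) (d # ds)) =
      (\<Sum>b\<in>cuts d. F (us @ g b # map (\<lambda>d. \<Sum>b\<in>cuts d. g b) ds))"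
    using Cons.prems assms(1,2)
    by (simp, intro multilinear_sum) (auto intro!: total_space_sum)
  also have "\<dots> = (\<Sum>b\<in>cuts d. F ((us @ [g b]) @ map (\<lambda>d. \<Sum>b\<in>cuts d. g b) ds))"
    by simp
  also have "\<dots> = (\<Sum>b\<in>cuts d. \<Sum>bs\<in>refinements ds. F ((us @ [g b]) @ map g bs))"
    using Cons.prems by (intro sum.cong[OF refl] Cons.IH) auto
  also have "\<dots> = (\<Sum>(b, bs)\<in>cuts d \<times> refinements ds. F (us @ map g (b # bs)))"
    by (simp add: sum.cartesian_product)
  also have "\<dots> = (\<Sum>bs\<in>refinements (d # ds). F (us @ map g bs))"
    unfolding refinements_Cons by (subst sum.reindex) (auto intro!: inj_onI sum.cong)
  finally show ?case .
qed

lemma has_degrees_Cons: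
  "has_degrees A (x # xs) ds \<longleftrightarrow> (\<exists>d es. ds = d # es \<and> x \<in> part A d \<and> has_degrees A xs es)"
  by (auto simp: has_degrees_def list_all2_Cons1)

lemma has_degrees_map:
  "has_degrees A (map f bs) (map g bs) \<longleftrightarrow> (\<forall>b\<in>set bs. f b \<in> part A (g b))"
  by (simp add: has_degrees_def list_all2_map1 list_all2_map2 list_all2_same)

lemma has_degrees_zip:
  assumes "has_degrees A xs ds"
  obtains zs where "xs = map fst zs" "ds = map snd zs" "\<forall>z\<in>set zs. fst z \<in> part A (snd z)"
proof
  from assms have l: "length xs = length ds" by (auto simp: has_degrees_def dest: list_all2_lengthD)
  then show "xs = map fst (zip xs ds)" "ds = map snd (zip xs ds)" by auto
  from assms show "\<forall>z\<in>set (zip xs ds). fst z \<in> part A (snd z)"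
    by (auto simp: has_degrees_def list_all2_iff)
qed

text \<open>
  Homogeneity controls only homogeneous arguments; the others are reached by multilinearity, one
  argument after the other.
\<close>

lemma total_space_value:
  assumes A: "graded_vector_space A" and B: "graded_vector_space B"
    and lin: "multilinear A B F" and deg: "homogeneous_of_degree r A B F"
    and "set xs \<subseteq> total_space A" "xs \<noteq> []"
  shows "F xs \<in> total_space B"
proof -
  interpret a: vector_space "scal A" using A by (simp add: graded_vector_space_def)
  have "F (us @ vs) \<in> total_space B"
    if "set us \<subseteq> (\<Union>d. part A d)" "set vs \<subseteq> total_space A" "us @ vs \<noteq> []" for us vs
    using that
  proof (induction vs arbitrary: us)
    case Nil
    then have "\<exists>ds. has_degrees A us ds"
    proof (induction us)
      case (Cons u us)
      then have "\<exists>ds. has_degrees A us ds" by (cases us) (auto simp: has_degrees_def)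
      with Cons.prems show ?case unfolding has_degrees_Cons by auto
    qed auto
    with Nil deg have "\<exists>d. F us \<in> part B d" by (auto simp: homogeneous_of_degree_def)
    then show ?case using part_total_space[OF B] by auto
  next
    case (Cons v vs)
    have us: "set us \<subseteq> total_space A" using Cons.prems part_total_space[OF A] by blast
    have vs: "set vs \<subseteq> total_space A" using Cons.prems by auto
    have "v \<in> total_space A" using Cons.prems by simp
    then have "v \<in> total_space A \<and> F (us @ v # vs) \<in> total_space B"
      unfolding total_space_def[of A]
    proof (induction rule: a.span_induct_alt)
      case base
      show ?case using multilinear_0[OF A lin us vs] a.span_zero total_space_0[OF B] by simp
    next
      case (step c x y)
      then have x: "x \<in> total_space A" and y: "y \<in> total_space A"
        using part_total_space[OF A] by (auto simp: total_space_def[of A])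
      have cx: "scal A c x \<in> total_space A" using A x by (rule total_space_scal)
      have "F (us @ x # vs) \<in> total_space B"
        using Cons.IH[of "us @ [x]"] Cons.prems step(1) by auto
      then have "F (us @ (scal A c x + y) # vs) \<in> total_space B"
        using step(2) x y
        by (simp add: multilinear_add[OF lin us vs cx y] multilinear_scal[OF lin us vs x]
            total_space_add[OF B] total_space_scal[OF B])
      with total_space_add[OF A cx y] show ?case by (simp add: total_space_def[of A])
    qed
    then show ?case by simp
  qed
  from this[of "[]" xs] assms(5,6) show ?thesis by simp
qed

section \<open>Composition of A-infinity morphisms\<close>

lemma total_space_values:
  assumes "graded_vector_space A" "graded_vector_space B" "multilinear A B F"
    "homogeneous_of_degree r A B F" and bs: "set (concat bs) \<subseteq> total_space A" "[] \<notin> set bs"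
  shows "set (map F bs) \<subseteq> total_space B"
proof -
  have "F b \<in> total_space B" if "b \<in> set bs" for b
  proof (rule total_space_value[OF assms(1-4)])
    show "set b \<subseteq> total_space A" using set_block[OF that] bs(1) by (rule subset_trans)
    show "b \<noteq> []" using that bs(2) by auto
  qed
  then show ?thesis by auto
qed

lemma ainf_comp_assoc:
  assumes "graded_vector_space B" "multilinear B C H"
    and "\<And>d b. \<lbrakk>d \<noteq> []; set d \<subseteq> set xs; b \<in> cuts d\<rbrakk> \<Longrightarrow> G (map F b) \<in> total_space B"
  shows "ainf_comp H (ainf_comp G F) xs = ainf_comp (ainf_comp H G) F xs"
proof -
  have sub: "d \<noteq> [] \<and> set d \<subseteq> set xs" if "dss \<in> cuts xs" "d \<in> set dss" for d dss
    using that by (auto simp: cuts_def)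
  have "ainf_comp H (ainf_comp G F) xs =
      (\<Sum>dss\<in>cuts xs. H ([] @ map (\<lambda>d. \<Sum>b\<in>cuts d. G (map F b)) dss))"
    by (simp add: ainf_comp_cuts[of H] ainf_comp_cuts[of G, abs_def])
  also have "\<dots> = (\<Sum>dss\<in>cuts xs. \<Sum>css\<in>refinements dss. H ([] @ map (\<lambda>b. G (map F b)) css))"
  proof (rule sum.cong[OF refl], rule multilinear_sum_refinements[OF assms(1,2)])
    fix dss d b assume "dss \<in> cuts xs" "d \<in> set dss" "b \<in> cuts d"
    with sub[of dss d] show "G (map F b) \<in> total_space B" by (intro assms(3)) auto
  qed simp
  also have "\<dots> = (\<Sum>bss\<in>cuts xs. \<Sum>css\<in>cuts bss. H (map (\<lambda>b. G (map F b)) css))"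
    by (simp add: sum_cuts_cuts)
  also have "\<dots> = ainf_comp (ainf_comp H G) F xs"
    by (simp add: ainf_comp_cuts sum_cuts_map o_def)
  finally show ?thesis .
qed

text \<open>
  These forms of the composition isolate the one block that depends on the entry \<open>x\<close>. In the second
  one the other entries carry degrees, while \<open>x\<close> is a value for which no degree is recorded.
\<close>

lemma ainf_comp_at_entry:
  "ainf_comp G F (A @ x # C) =
   (\<Sum>((us, a), (c, vs))\<in>left_cuts A \<times> right_cuts C. G (map F us @ F (a @ x # c) # map F vs))"
  by (simp add: ainf_comp_cuts sum_cuts_at_entry)

lemma ainf_comp_at_entry_fst:
  fixes A C :: "('a \<times> 'b) list"
  shows "ainf_comp G F (map fst A @ x # map fst C) =
   (\<Sum>((us, a), (c, vs))\<in>left_cuts A \<times> right_cuts C.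
      G (map (\<lambda>b. F (map fst b)) us @ F (map fst a @ x # map fst c) # map (\<lambda>b. F (map fst b)) vs))"
proof -
  \<comment> \<open>The second component of the new entry is projected away again.\<close>
  have "ainf_comp G F (map fst A @ x # map fst C) = ainf_comp G F (map fst (A @ (x, undefined) # C))"
    by simp
  also have "\<dots> = (\<Sum>bss\<in>cuts (A @ (x, undefined) # C). G (map (\<lambda>b. F (map fst b)) bss))"
    by (simp only: ainf_comp_cuts sum_cuts_map map_map o_def)
  finally show ?thesis by (simp add: sum_cuts_at_entry)
qed

text \<open>
  A morphism has degree \<open>0\<close> in the suspended grading, so the value at a block \<open>b\<close> has the suspended
  degree of \<open>b\<close>, which is \<open>sdegree (map snd b) + 1\<close> in the unsuspended grading. Hence signs can be read off
  before or after applying the morphism to the blocks.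
\<close>

lemma sdegree_values:
  "sdegree (map (\<lambda>b. sdegree (map snd b) + 1) bs) = sdegree (map snd (concat bs))"
  by (induction bs) (auto simp: sdegree_def)

lemma homogeneous_0_value:
  assumes "homogeneous_of_degree 0 A B F" "xs \<noteq> []" "\<forall>z\<in>set xs. fst z \<in> part A (snd z)"
  shows "F (map fst xs) \<in> part B (sdegree (map snd xs) + 1)"
  using assms has_degrees_map[of A fst xs snd] by (auto simp: homogeneous_of_degree_def)

lemma ainf_comp_multilinear:
  assumes A: "graded_vector_space A" and B: "graded_vector_space B" and C: "graded_vector_space C"
    and F: "multilinear A B F" "homogeneous_of_degree 0 A B F" and G: "multilinear B C G"
  shows "multilinear A C (ainf_comp G F)"
  unfolding multilinear_def
proof (intro allI impI, elim conjE)
  fix ps qs x y c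
  assume ps: "set ps \<subseteq> total_space A" and qs: "set qs \<subseteq> total_space A"
    and x: "x \<in> total_space A" and y: "y \<in> total_space A"
  let ?I = "left_cuts ps \<times> right_cuts qs"
  let ?t = "\<lambda>z ((us, a), (c, vs)). G (map F us @ F (a @ z # c) # map F vs)"
  note val = total_space_value[OF A B F]
  have *: "?t (x + y) i = ?t x i + ?t y i \<and> ?t (scal A c x) i = scal C c (?t x i)" if "i \<in> ?I" for i
  proof -
    obtain us a d vs where i: "i = ((us, a), (d, vs))" by (metis prod.exhaust)
    have us: "concat us @ a = ps" "[] \<notin> set us" and vs: "d @ concat vs = qs" "[] \<notin> set vs"
      using that i by (auto simp: left_cuts_def right_cuts_def)
    have ad: "set a \<subseteq> total_space A" "set d \<subseteq> total_space A"
      and uv: "set (concat us) \<subseteq> total_space A" "set (concat vs) \<subseteq> total_space A"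
      using us(1) vs(1) ps qs by (auto simp del: set_concat)
    have m: "set (map F us) \<subseteq> total_space B" "set (map F vs) \<subseteq> total_space B"
      using total_space_values[OF A B F uv(1) us(2)] total_space_values[OF A B F uv(2) vs(2)] by blast+
    have e: "F (a @ z # d) \<in> total_space B" if "z \<in> total_space A" for z
      using that ad by (intro val) auto
    show ?thesis
      by (simp add: i multilinear_add[OF F(1) ad x y] multilinear_scal[OF F(1) ad x]
          multilinear_add[OF G m e[OF x] e[OF y]] multilinear_scal[OF G m e[OF x]])
  qed
  show "ainf_comp G F (ps @ (x + y) # qs) = ainf_comp G F (ps @ x # qs) + ainf_comp G F (ps @ y # qs) \<and>
      ainf_comp G F (ps @ scal A c x # qs) = scal C c (ainf_comp G F (ps @ x # qs))"
    using * by (simp add: ainf_comp_at_entry sum.distrib[symmetric] scal_sum[OF C] cong: sum.cong)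
qed

lemma ainf_comp_homogeneous:
  assumes C: "graded_vector_space C"
    and F: "homogeneous_of_degree 0 A B F" and G: "homogeneous_of_degree 0 B C G"
  shows "homogeneous_of_degree 0 A C (ainf_comp G F)"
  unfolding homogeneous_of_degree_def
proof (intro allI impI, elim conjE)
  fix xs ds assume ne: "xs \<noteq> []" and "has_degrees A xs ds"
  then obtain zs where zs: "xs = map fst zs" "ds = map snd zs" "\<forall>z\<in>set zs. fst z \<in> part A (snd z)"
    by (blast elim: has_degrees_zip)
  let ?g = "\<lambda>b. sdegree (map snd b) + 1"
  have "G (map (\<lambda>b. F (map fst b)) bs) \<in> part C (sdegree (map snd zs) + 1)" if "bs \<in> cuts zs" for bs
  proof -
    from that have bs: "concat bs = zs" "[] \<notin> set bs" by (auto simp: cuts_def)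
    then have "has_degrees B (map (\<lambda>b. F (map fst b)) bs) (map ?g bs)"
      using zs(3) unfolding has_degrees_map by (intro ballI homogeneous_0_value[OF F]) auto
    moreover have "bs \<noteq> []" using bs ne zs(1) by auto
    ultimately have "G (map (\<lambda>b. F (map fst b)) bs) \<in> part C (sdegree (map ?g bs) + 0 + 1)"
      using G unfolding homogeneous_of_degree_def by blast
    then show ?thesis by (simp add: sdegree_values bs)
  qed
  then show "ainf_comp G F xs \<in> part C (sdegree ds + 0 + 1)"
    by (auto simp: ainf_comp_cuts zs sum_cuts_map o_def intro!: part_sum[OF C])
qed

text \<open>
  The chain of equations is \<open>Q\<^sub>C \<circ> (G \<circ> F) = (Q\<^sub>C \<circ> G) \<circ> F = (G \<circ> Q\<^sub>B) \<circ> F = G \<circ> (Q\<^sub>B \<circ> F) = G \<circ> (F \<circ> Q\<^sub>A) =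
  (G \<circ> F) \<circ> Q\<^sub>A\<close>. The middle step, in which \<open>Q\<^sub>B\<close> moves past \<open>F\<close>, and the last one are the two
  regroupings of sums over factorizations.
\<close>

lemma ainf_comp_relation:
  fixes A :: "('k::field, 'a::ab_group_add) ainf"
  assumes A: "graded_vector_space A" and B: "graded_vector_space B"
    and C: "graded_vector_space C"
    and FL: "multilinear A B F" and F: "homogeneous_of_degree 0 A B F"
    and G: "multilinear B C G" and G0: "homogeneous_of_degree 0 B C G"
    and QA: "homogeneous_of_degree 1 A A (opn A)" and QB: "homogeneous_of_degree 1 B B (opn B)"
    and QC: "multilinear C C (opn C)"
    and Frel: "\<And>xs ds. \<lbrakk>xs \<noteq> []; has_degrees A xs ds\<rbrakk> \<Longrightarrow>
      ainf_comp (opn B) F xs = comp_coderivation F (opn A) ds xs"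
    and Grel: "\<And>xs ds. \<lbrakk>xs \<noteq> []; has_degrees B xs ds\<rbrakk> \<Longrightarrow>
      ainf_comp (opn C) G xs = comp_coderivation G (opn B) ds xs"
    and xs: "xs \<noteq> []" "has_degrees A xs ds"
  shows "ainf_comp (opn C) (ainf_comp G F) xs = comp_coderivation (ainf_comp G F) (opn A) ds xs"
proof -
  obtain zs where zs: "xs = map fst zs" "ds = map snd zs" "\<forall>z\<in>set zs. fst z \<in> part A (snd z)"
    using xs(2) by (rule has_degrees_zip)
  let ?f = "\<lambda>b. F (map fst b)" and ?g = "\<lambda>b. sdegree (map snd b) + 1"
  let ?s = "\<lambda>us. sdegree (map snd us)"
  have f: "?f b \<in> part B (?g b)" if "b \<noteq> []" "set b \<subseteq> set zs" for b
    using that zs(3) by (intro homogeneous_0_value[OF F]) auto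
  have blocks: "b \<noteq> [] \<and> set b \<subseteq> set zs" if "bs \<in> cuts d" "b \<in> set bs" "set d \<subseteq> set zs" for b bs d
    using that set_block[OF that(2)] by (auto simp: cuts_def simp del: set_concat)
  have degs: "has_degrees B (map ?f bs) (map ?g bs)" if "bs \<in> cuts d" "set d \<subseteq> set zs" for bs d
    unfolding has_degrees_map using f blocks[OF that(1) _ that(2)] by blast
  have tot: "set (map ?f bs) \<subseteq> total_space B" if "bs \<in> cuts d" "set d \<subseteq> set zs" for bs d
    using f blocks[OF that(1) _ that(2)] by (auto intro!: part_total_space[OF B f])

  have "ainf_comp (opn C) (ainf_comp G F) xs = ainf_comp (ainf_comp (opn C) G) F xs"
  proof (rule ainf_comp_assoc[OF C QC])
    fix d b assume d: "d \<noteq> []" "set d \<subseteq> set xs" "b \<in> cuts d"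
    have "set d \<subseteq> total_space A" using d(2) zs part_total_space[OF A] by fastforce
    with d(3) have "set (map F b) \<subseteq> total_space B"
      by (intro total_space_values[OF A B FL F]) (auto simp: cuts_def simp del: set_concat)
    then show "G (map F b) \<in> total_space C"
      using cuts_ne[OF d(3,1)] by (intro total_space_value[OF B C G G0]) simp_all
  qed
  also have "\<dots> = (\<Sum>bs\<in>cuts zs. ainf_comp (opn C) G (map ?f bs))"
    by (simp add: ainf_comp_cuts[of _ F] zs(1) sum_cuts_map o_def)
  also have "\<dots> = (\<Sum>bs\<in>cuts zs. comp_coderivation G (opn B) (map ?g bs) (map ?f bs))"
    using xs(1) zs(1) by (intro sum.cong[OF refl] Grel degs[of _ zs]) (auto dest: cuts_ne)
  also have "\<dots> = (\<Sum>bs\<in>cuts zs. \<Sum>(us, ys, vs)\<in>factors bs.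
      signed (?s (concat us)) (G (map ?f us @ opn B (map ?f ys) # map ?f vs)))"
    by (simp add: comp_coderivation_factors sdegree_values)
  also have "\<dots> = (\<Sum>(p, m, q)\<in>factors zs. \<Sum>us\<in>cuts p. \<Sum>vs\<in>cuts q. \<Sum>ys\<in>cuts m.
      signed (?s (concat us)) (G (map ?f us @ opn B (map ?f ys) # map ?f vs)))"
    by (rule sum_factors_of_cuts)
  also have "\<dots> = (\<Sum>(p, m, q)\<in>factors zs. \<Sum>us\<in>cuts p. \<Sum>vs\<in>cuts q. \<Sum>(a, b, c)\<in>factors m.
      signed (?s (concat us @ a))
        (G (map ?f us @ F (map fst a @ opn A (map fst b) # map fst c) # map ?f vs)))"
  proof (rule sum.cong[OF refl], clarify, intro sum.cong[OF refl])
    fix p m q us vs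
    assume pmq: "(p, m, q) \<in> factors zs" and us: "us \<in> cuts p" and vs: "vs \<in> cuts q"
    then have sub: "set p \<subseteq> set zs" "set m \<subseteq> set zs" "set q \<subseteq> set zs" and m: "m \<noteq> []"
      by (auto simp: factors_def)
    note tu = tot[OF us sub(1)] and tv = tot[OF vs sub(3)]
    have mdeg: "has_degrees A (map fst m) (map snd m)"
      using zs(3) sub(2) by (auto simp: has_degrees_map)
    have "(\<Sum>ys\<in>cuts m. opn B (map ?f ys)) = ainf_comp (opn B) F (map fst m)"
      by (simp add: ainf_comp_cuts sum_cuts_map o_def)
    also have "\<dots> = comp_coderivation F (opn A) (map snd m) (map fst m)"
      using m mdeg by (intro Frel) auto
    also have "\<dots> = (\<Sum>(a, b, c)\<in>factors m.
        signed (?s a) (F (map fst a @ opn A (map fst b) # map fst c)))"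
      by (rule comp_coderivation_factors)
    \<comment> \<open>The relation of \<open>F\<close>, applied to the segment \<open>m\<close> alone.\<close>
    finally have rel: "(\<Sum>ys\<in>cuts m. opn B (map ?f ys)) = \<dots>" .
    \<comment> \<open>The value of \<open>Q\<^sub>A\<close> is homogeneous, so \<open>F\<close> is evaluated at homogeneous arguments.\<close>
    have inner: "F (map fst a @ opn A (map fst b) # map fst c) \<in> total_space B"
      if "(a, b, c) \<in> factors m" for a b c
    proof -
      from that sub(2) zs(3) have abc: "\<forall>z\<in>set a. fst z \<in> part A (snd z)"
        "\<forall>z\<in>set b. fst z \<in> part A (snd z)" "\<forall>z\<in>set c. fst z \<in> part A (snd z)" "b \<noteq> []"
        by (auto simp: factors_def)
      then have "opn A (map fst b) \<in> part A (?s b + 1 + 1)"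
        using QA has_degrees_map[of A fst b snd] unfolding homogeneous_of_degree_def by blast
      with abc have "F (map fst (a @ (opn A (map fst b), ?s b + 1 + 1) # c)) \<in>
          part B (?s (a @ (opn A (map fst b), ?s b + 1 + 1) # c) + 1)"
        by (intro homogeneous_0_value[OF F]) auto
      then show ?thesis by (auto intro: part_total_space[OF B])
    qed
    have opn: "opn B (map ?f ys) \<in> total_space B" if "ys \<in> cuts m" for ys
      using QB degs[OF that sub(2)] cuts_ne[OF that m] part_total_space[OF B]
      unfolding homogeneous_of_degree_def by blast
    let ?G = "\<lambda>y. G (map ?f us @ y # map ?f vs)"
    have "(\<Sum>ys\<in>cuts m. signed (?s (concat us)) (?G (opn B (map ?f ys)))) =
        signed (?s (concat us)) (?G (\<Sum>ys\<in>cuts m. opn B (map ?f ys)))"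
      by (simp only: multilinear_sum[OF B G tu tv opn] signed_sum)
    also have "\<dots> = signed (?s (concat us)) (\<Sum>x\<in>factors m. case x of (a, b, c) \<Rightarrow>
        signed (?s a) (?G (F (map fst a @ opn A (map fst b) # map fst c))))"
      unfolding rel using inner
      by (subst multilinear_sum[OF B G tu tv])
        (auto intro!: total_space_signed[OF B] arg_cong[of _ _ "signed _"] sum.cong
          multilinear_signed[OF B G tu tv])
    also have "\<dots> = (\<Sum>(a, b, c)\<in>factors m. signed (?s (concat us @ a))
        (?G (F (map fst a @ opn A (map fst b) # map fst c))))"
      by (auto simp: signed_sum signed_signed sdegree_append intro!: sum.cong)
    finally show "(\<Sum>ys\<in>cuts m. signed (?s (concat us)) (?G (opn B (map ?f ys)))) = \<dots>" .
  qed
  also have "\<dots> = (\<Sum>(P, b, R)\<in>factors zs. \<Sum>((us, a), (c, vs))\<in>left_cuts P \<times> right_cuts R.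
      signed (?s (concat us @ a))
        (G (map ?f us @ F (map fst a @ opn A (map fst b) # map fst c) # map ?f vs)))"
    by (rule sum_factors_of_blocks)
  also have "\<dots> = (\<Sum>(P, b, R)\<in>factors zs.
      signed (?s P) (ainf_comp G F (map fst P @ opn A (map fst b) # map fst R)))"
  proof (rule sum.cong[OF refl], clarify)
    fix P b R :: "('a \<times> int) list"
    show "(\<Sum>((us, a), (c, vs))\<in>left_cuts P \<times> right_cuts R. signed (?s (concat us @ a))
        (G (map ?f us @ F (map fst a @ opn A (map fst b) # map fst c) # map ?f vs))) =
        signed (?s P) (ainf_comp G F (map fst P @ opn A (map fst b) # map fst R))"
      unfolding ainf_comp_at_entry_fst signed_sum
      by (intro sum.cong[OF refl]) (auto simp: left_cuts_def)
  qed
  also have "\<dots> = comp_coderivation (ainf_comp G F) (opn A) ds xs"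
    by (simp add: zs comp_coderivation_factors)
  finally show ?thesis .
qed

lemma unital_ainf_algebraD:
  assumes "unital_ainf_algebra A"
  shows "graded_vector_space A" "multilinear A A (opn A)" "homogeneous_of_degree 1 A A (opn A)"
    "unt A \<in> part A 0"
  using assms unfolding unital_ainf_algebra_def by blast+

lemma unital_ainf_morphismD:
  assumes "unital_ainf_morphism A B F"
  shows "unital_ainf_algebra A" "unital_ainf_algebra B" "multilinear A B F"
    "homogeneous_of_degree 0 A B F"
    "\<And>xs ds. xs \<noteq> [] \<Longrightarrow> has_degrees A xs ds \<Longrightarrow>
      ainf_comp (opn B) F xs = comp_coderivation F (opn A) ds xs"
    "F [unt A] = unt B"
    "\<And>xs. set xs \<subseteq> total_space A \<Longrightarrow> length xs \<ge> 2 \<Longrightarrow> unt A \<in> set xs \<Longrightarrow> F xs = 0"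
proof -
  note * = assms[unfolded unital_ainf_morphism_def]
  show "unital_ainf_algebra A" "unital_ainf_algebra B" "multilinear A B F"
    "homogeneous_of_degree 0 A B F" "F [unt A] = unt B"
    using * by blast+
  have "\<forall>xs ds. xs \<noteq> [] \<and> has_degrees A xs ds \<longrightarrow>
      ainf_comp (opn B) F xs = comp_coderivation F (opn A) ds xs"
    using * by (elim conjE)
  then show "ainf_comp (opn B) F xs = comp_coderivation F (opn A) ds xs"
    if "xs \<noteq> []" "has_degrees A xs ds" for xs ds
    using that by blast
  have "\<forall>xs. set xs \<subseteq> total_space A \<and> length xs \<ge> 2 \<and> unt A \<in> set xs \<longrightarrow> F xs = 0"
    using * by (elim conjE)
  then show "F xs = 0" if "set xs \<subseteq> total_space A" "length xs \<ge> 2" "unt A \<in> set xs" for xs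
    using that by blast
qed

text \<open>
  For unitality, let \<open>1\<close> be an argument. If its block has other entries, then \<open>F\<close> vanishes there;
  otherwise the block becomes \<open>1\<close>, and \<open>G\<close> vanishes as soon as there is another block.
\<close>

theorem unital_ainf_morphism_comp:
  assumes F: "unital_ainf_morphism A B F" and G: "unital_ainf_morphism B C G"
  shows "unital_ainf_morphism A C (ainf_comp G F)"
proof -
  note F = unital_ainf_morphismD[OF F] and G = unital_ainf_morphismD[OF G]
  note gvs = unital_ainf_algebraD(1)[OF F(1)] unital_ainf_algebraD(1)[OF F(2)]
    unital_ainf_algebraD(1)[OF G(2)]
  have rel: "ainf_comp (opn C) (ainf_comp G F) xs = comp_coderivation (ainf_comp G F) (opn A) ds xs"
    if "xs \<noteq> []" "has_degrees A xs ds" for xs ds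
    by (rule ainf_comp_relation[OF gvs F(3,4) G(3,4) unital_ainf_algebraD(3)[OF F(1)]
      unital_ainf_algebraD(3)[OF F(2)] unital_ainf_algebraD(2)[OF G(2)]]) (fact F(5) G(5) that)+
  note unitB = unital_ainf_algebraD(4)[OF F(2)]
  have unital: "ainf_comp G F xs = 0"
    if xs: "set xs \<subseteq> total_space A" "length xs \<ge> 2" "unt A \<in> set xs" for xs
  proof -
    from xs(3) obtain P R where PR: "xs = P @ unt A # R" by (meson split_list)
    have "G (map F us @ F (a @ unt A # c) # map F vs) = 0"
      if i: "((us, a), (c, vs)) \<in> left_cuts P \<times> right_cuts R" for us a c vs
    proof -
      from i have us: "concat us @ a = P" "[] \<notin> set us" and vs: "c @ concat vs = R" "[] \<notin> set vs"
        by (auto simp: left_cuts_def right_cuts_def)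
      then have sub: "set a \<subseteq> total_space A" "set c \<subseteq> total_space A"
        "set (concat us) \<subseteq> total_space A" "set (concat vs) \<subseteq> total_space A"
        using xs(1) PR by (auto simp del: set_concat)
      then have tot: "set (map F us) \<subseteq> total_space B" "set (map F vs) \<subseteq> total_space B"
        using total_space_values[OF gvs(1,2) F(3,4) sub(3) us(2)]
          total_space_values[OF gvs(1,2) F(3,4) sub(4) vs(2)] by blast+
      have one: "unt A \<in> total_space A" using xs(1,3) by auto
      show ?thesis
      proof (cases "a = [] \<and> c = []")
        case True
        then have "us \<noteq> [] \<or> vs \<noteq> []" using us vs xs(2) PR by auto
        then have "length (map F us @ unt B # map F vs) \<ge> 2" by (cases us; cases vs) simp_all
        moreover have "set (map F us @ unt B # map F vs) \<subseteq> total_space B"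
          using tot part_total_space[OF gvs(2) unitB] by simp
        ultimately have "G (map F us @ unt B # map F vs) = 0" by (intro G(7)) simp_all
        then show ?thesis using True F(6) by simp
      next
        case False
        then have "length (a @ unt A # c) \<ge> 2" by (cases a; cases c) simp_all
        then have "F (a @ unt A # c) = 0" using sub one by (intro F(7)) simp_all
        then show ?thesis using multilinear_0[OF gvs(2) G(3) tot] by simp
      qed
    qed
    then show ?thesis unfolding PR ainf_comp_at_entry by (intro sum.neutral) auto
  qed
  have "ainf_comp G F [unt A] = unt C"
    by (simp add: ainf_comp_cuts cuts_singleton F(6) G(6))
  with rel unital F(1) G(2) ainf_comp_multilinear[OF gvs F(3,4) G(3)]
    ainf_comp_homogeneous[OF gvs(3) F(4) G(4)]
  show ?thesis unfolding unital_ainf_morphism_def by blast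
qed

section \<open>Binomial and Bernoulli polynomials\<close>

abbreviation (input) log_coeff :: "nat \<Rightarrow> 'k::field_char_0" where
  "log_coeff n \<equiv> (-1) ^ (n + 1) / of_nat n"

lemma smult_sum_right: "smult c (\<Sum>i\<in>I. f i) = (\<Sum>i\<in>I. smult c (f i))"
  by (induction I rule: infinite_finite_induct) (auto simp: smult_add_right)

lemma smult_left_cancel: "c \<noteq> 0 \<Longrightarrow> smult c p = smult c q \<Longrightarrow> p = q" for c :: "'a::field"
  by (metis smult_smult left_inverse smult_1_left)

lemma pderiv_sum: "pderiv (\<Sum>i\<in>I. f i) = (\<Sum>i\<in>I. pderiv (f i))"
  by (induction I rule: infinite_finite_induct) (auto simp: pderiv_add)

lemma binomial_poly_0: "binomial_poly \<tau> 0 = 1"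
  by (simp add: binomial_poly_def)

lemma binomial_poly_Suc:
  "smult (of_nat (Suc n)) (binomial_poly \<tau> (Suc n)) = (\<tau> - of_nat n) * binomial_poly \<tau> n"
  by (simp add: binomial_poly_def field_simps del: of_nat_Suc)

lemma poly_binomial_poly: "poly (binomial_poly \<tau> n) x = poly \<tau> x gchoose n"
  by (simp add: binomial_poly_def gbinomial_prod_rev poly_prod lessThan_atLeast0)

text \<open>
  This is the coefficient of \<open>z\<^sup>n\<close> in \<open>d/d\<tau> (1 + z)\<^sup>\<tau> = log (1 + z) (1 + z)\<^sup>\<tau>\<close>. The proof compares the
  recurrences in \<open>n\<close> of both sides.
\<close>

lemma pderiv_binomial_poly:
  "pderiv (binomial_poly \<tau> n) =
   pderiv \<tau> * (\<Sum>a=1..n. smult (log_coeff a) (binomial_poly \<tau> (n - a)))"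
proof (induction n)
  case 0
  show ?case by (simp add: binomial_poly_0)
next
  case (Suc n)
  let ?b = "binomial_poly \<tau>"
  let ?S = "\<lambda>n. \<Sum>a=1..n. smult (log_coeff a) (?b (n - a))"
  \<comment> \<open>Split \<open>\<tau> - n = (\<tau> - (n - a)) - a\<close> to apply the recurrence at \<open>n - a\<close>.\<close>
  have step: "(\<tau> - of_nat n) * ?b (n - a) =
      smult (of_nat (Suc n - a)) (?b (Suc n - a)) - smult (of_nat a) (?b (n - a))"
    if "a \<le> n" for a
  proof -
    have "(\<tau> - of_nat n) * ?b (n - a) = (\<tau> - of_nat (n - a)) * ?b (n - a) - of_nat a * ?b (n - a)"
      using that by (simp add: of_nat_diff algebra_simps)
    then show ?thesis
      using that binomial_poly_Suc[of "n - a" \<tau>] by (simp add: Suc_diff_le of_nat_poly)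
  qed
  \<comment> \<open>Split \<open>n + 1 = (n + 1 - a) + a\<close>. As \<open>a c\<^sub>a = (-1)\<^bsup>a+1\<^esup>\<close>, the second part loses its denominators;
    its term for \<open>a = 1\<close> matches the contribution of differentiating the new factor \<open>\<tau> - n\<close>.\<close>
  have "smult (of_nat (Suc n)) (?S (Suc n)) =
      (\<Sum>a=1..Suc n. smult (log_coeff a * of_nat (Suc n - a)) (?b (Suc n - a)))
      + (\<Sum>a=1..Suc n. smult ((-1) ^ (a + 1)) (?b (Suc n - a)))"
    unfolding smult_sum_right sum.distrib[symmetric]
  proof (rule sum.cong[OF refl])
    fix a assume a: "a \<in> {1..Suc n}"
    then have "log_coeff a * of_nat (Suc n - a) + (-1) ^ (a + 1) = (of_nat (Suc n) * log_coeff a :: 'a)"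
      by (simp add: of_nat_diff field_simps)
    then show "smult (of_nat (Suc n)) (smult (log_coeff a) (?b (Suc n - a))) =
        smult (log_coeff a * of_nat (Suc n - a)) (?b (Suc n - a)) + smult ((-1) ^ (a + 1)) (?b (Suc n - a))"
      by (simp only: smult_smult smult_add_left[symmetric])
  qed
  also have "(\<Sum>a=1..Suc n. smult (log_coeff a * of_nat (Suc n - a)) (?b (Suc n - a))) =
      (\<Sum>a=1..n. smult (log_coeff a * of_nat (Suc n - a)) (?b (Suc n - a)))"
    by simp
  also have "(\<Sum>a=1..Suc n. smult ((-1) ^ (a + 1)) (?b (Suc n - a))) =
      (\<Sum>a=0..n. smult ((-1) ^ a) (?b (n - a)))"
    unfolding One_nat_def sum.atLeast_Suc_atMost_Suc_shift by simp
  also have "\<dots> = ?b n + (\<Sum>a=1..n. smult ((-1) ^ a) (?b (n - a)))"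
    by (simp add: sum.atLeast_Suc_atMost)
  also have "(\<Sum>a=1..n. smult (log_coeff a * of_nat (Suc n - a)) (?b (Suc n - a)))
        + (?b n + (\<Sum>a=1..n. smult ((-1) ^ a) (?b (n - a)))) =
      ?b n + (\<Sum>a=1..n. smult (log_coeff a * of_nat (Suc n - a)) (?b (Suc n - a))
        + smult ((-1) ^ a) (?b (n - a)))"
    by (simp only: sum.distrib ac_simps)
  also have "(\<Sum>a=1..n. smult (log_coeff a * of_nat (Suc n - a)) (?b (Suc n - a))
        + smult ((-1) ^ a) (?b (n - a))) = (\<Sum>a=1..n. smult (log_coeff a) ((\<tau> - of_nat n) * ?b (n - a)))"
  proof (rule sum.cong[OF refl])
    fix a assume a: "a \<in> {1..n}"
    then show "smult (log_coeff a * of_nat (Suc n - a)) (?b (Suc n - a)) + smult ((-1) ^ a) (?b (n - a)) =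
        smult (log_coeff a) ((\<tau> - of_nat n) * ?b (n - a))"
      by (simp add: step smult_diff_right)
  qed
  also have "\<dots> = (\<tau> - of_nat n) * ?S n"
    by (simp add: sum_distrib_left)
  finally have S: "smult (of_nat (Suc n)) (?S (Suc n)) = ?b n + (\<tau> - of_nat n) * ?S n" .
  have "smult (of_nat (Suc n)) (pderiv (?b (Suc n))) = pderiv ((\<tau> - of_nat n) * ?b n)"
    by (metis binomial_poly_Suc pderiv_smult)
  also have "\<dots> = pderiv \<tau> * ?b n + (\<tau> - of_nat n) * pderiv (?b n)"
    by (simp add: pderiv_mult pderiv_diff algebra_simps)
  also have "\<dots> = pderiv \<tau> * (?b n + (\<tau> - of_nat n) * ?S n)"
    by (simp add: Suc.IH algebra_simps)
  also have "\<dots> = smult (of_nat (Suc n)) (pderiv \<tau> * ?S (Suc n))"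
    by (simp only: S[symmetric] mult_smult_right)
  finally show ?case by (rule smult_left_cancel[OF of_nat_neq_0])
qed

text \<open>
  The exponents \<open>1 - t\<close> and \<open>t\<close> add up to \<open>1\<close>, so the sum is the binomial coefficient of \<open>1\<close> over \<open>n\<close>.
\<close>

lemma binomial_poly_Vandermonde:
  "(\<Sum>l\<le>n. binomial_poly [:1, -1:] l * binomial_poly [:0, 1:] (n - l)) =
   (if n \<le> 1 then 1 else (0 :: 'k::field_char_0 poly))"
proof -
  have "poly (\<Sum>l\<le>n. binomial_poly [:1, -1:] l * binomial_poly [:0, 1:] (n - l)) x =
      poly (if n \<le> 1 then 1 else 0) x" for x :: 'k
  proof -
    have "poly (\<Sum>l\<le>n. binomial_poly [:1, -1:] l * binomial_poly [:0, 1:] (n - l)) x =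
        (of_nat 1 :: 'k) gchoose n"
      using gbinomial_Vandermonde[of "1 - x" x n] by (simp add: poly_sum poly_binomial_poly atMost_atLeast0)
    also have "\<dots> = of_nat (1 choose n)" by (rule binomial_gbinomial[symmetric])
    also have "\<dots> = poly (if n \<le> 1 then 1 else 0) x"
      by (cases n; cases "n - 1") (auto simp: binomial_eq_0)
    finally show ?thesis .
  qed
  then show ?thesis by (simp add: poly_eq_poly_eq_iff[symmetric] fun_eq_iff)
qed

text \<open>
  The coefficient of \<open>x\<^sup>i y\<^sup>j\<close> in \<open>((1 + x)\<^bsup>1-t\<^esup> (1 + y)\<^sup>t - (1 + x)) / (y - x)\<close>.
\<close>

definition binomial_sum :: "nat \<Rightarrow> nat \<Rightarrow> 'k::field_char_0 poly" where
  "binomial_sum i j = (\<Sum>l\<le>i. binomial_poly [:1, -1:] l * binomial_poly [:0, 1:] (i + j + 1 - l))"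

lemma poly_binomial_sum:
  "poly (binomial_sum i j) x = (\<Sum>l\<le>i. ((1 - x) gchoose l) * (x gchoose (i + j + 1 - l)))"
  by (simp add: binomial_sum_def poly_sum poly_binomial_poly)

lemma poly_binomial_sum_0: "poly (binomial_sum i j) 0 = 0"
  unfolding poly_binomial_sum by (intro sum.neutral) (auto simp: gbinomial_0_left)

text \<open>
  In terms of the generating function \<open>S(x, y)\<close> above, with \<open>L = log (1 + y) - log (1 + x)\<close>, this is
  \<open>dS/dt = L S + (1 + x) L / (y - x)\<close>. Differentiating the first factor of each summand gives the sum over
  \<open>a\<close>. Differentiating the second factor gives terms with \<open>1 \<le> b \<le> i + j + 1\<close>: for \<open>b \<le> j\<close> the sum over \<open>l\<close> is
  again a binomial sum, and for larger \<open>b\<close> it is a complete Vandermonde sum, nonzero at most for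
  \<open>b = i + j\<close> and \<open>b = i + j + 1\<close>.
\<close>

lemma pderiv_binomial_sum:
  "pderiv (binomial_sum i j :: 'k::field_char_0 poly) =
     [:log_coeff (i + j + 1):] + (if i \<ge> 1 then [:log_coeff (i + j):] else 0)
     - (\<Sum>a=1..i. smult (log_coeff a) (binomial_sum (i - a) j))
     + (\<Sum>b=1..j. smult (log_coeff b) (binomial_sum i (j - b)))"
proof -
  let ?c = "log_coeff :: nat \<Rightarrow> 'k"
  let ?u = "binomial_poly [:1, -1:] :: nat \<Rightarrow> 'k poly" and ?v = "binomial_poly [:0, 1:] :: nat \<Rightarrow> 'k poly"
  let ?N = "i + j + 1"
  have du: "pderiv (?u l) = - (\<Sum>a=1..l. smult (?c a) (?u (l - a)))" for l
    by (simp add: pderiv_binomial_poly pderiv_pCons)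
  have dv: "pderiv (?v l) = (\<Sum>a=1..l. smult (?c a) (?v (l - a)))" for l
    by (simp add: pderiv_binomial_poly pderiv_pCons)
  have 1: "(\<Sum>l\<le>i. \<Sum>a=1..l. smult (?c a) (?u (l - a) * ?v (?N - l))) =
      (\<Sum>a=1..i. smult (?c a) (binomial_sum (i - a) j))" (is "?l1 = ?r1")
  proof -
    have "?l1 = (\<Sum>(l, a)\<in>Sigma {..i} (\<lambda>l. {1..l}). smult (?c a) (?u (l - a) * ?v (?N - l)))"
      by (rule sum.Sigma) auto
    also have "\<dots> = (\<Sum>(a, l)\<in>Sigma {1..i} (\<lambda>a. {..i - a}).
        smult (?c a) (?u l * ?v (i - a + j + 1 - l)))"
      by (rule sum.reindex_bij_witness[of _ "\<lambda>(a, l). (l + a, a)" "\<lambda>(l, a). (a, l - a)"])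
        (auto intro!: arg_cong[of _ _ ?v] arg_cong2[of _ _ _ _ smult] arg_cong2[of _ _ _ _ "(*)"])
    also have "\<dots> = (\<Sum>a=1..i. \<Sum>l\<le>i - a. smult (?c a) (?u l * ?v (i - a + j + 1 - l)))"
      by (rule sum.Sigma[symmetric]) auto
    finally show ?thesis by (simp only: binomial_sum_def smult_sum_right)
  qed
  let ?w = "\<lambda>b. \<Sum>l\<in>{..min i (?N - b)}. ?u l * ?v (?N - b - l)"
  have 2: "(\<Sum>l\<le>i. \<Sum>b=1..?N - l. smult (?c b) (?u l * ?v (?N - l - b))) =
      (\<Sum>b=1..?N. smult (?c b) (?w b))" (is "?l2 = ?r2")
  proof -
    have "?l2 = (\<Sum>(l, b)\<in>Sigma {..i} (\<lambda>l. {1..?N - l}). smult (?c b) (?u l * ?v (?N - l - b)))"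
      by (rule sum.Sigma) auto
    also have "\<dots> = (\<Sum>(b, l)\<in>Sigma {1..?N} (\<lambda>b. {..min i (?N - b)}).
        smult (?c b) (?u l * ?v (?N - b - l)))"
      by (rule sum.reindex_bij_witness[of _ prod.swap prod.swap])
        (auto simp: diff_diff_left add.commute)
    also have "\<dots> = (\<Sum>b=1..?N. \<Sum>l\<in>{..min i (?N - b)}. smult (?c b) (?u l * ?v (?N - b - l)))"
      by (rule sum.Sigma[symmetric]) auto
    finally show ?thesis by (simp only: smult_sum_right)
  qed
  have "(\<Sum>b=1..?N. smult (?c b) (?w b)) =
      (\<Sum>b=1..j. smult (?c b) (?w b)) + (\<Sum>b=j+1..?N. smult (?c b) (?w b))"
    using sum.ub_add_nat[of 1 j "\<lambda>b. smult (?c b) (?w b)" "i + 1"] by (simp add: algebra_simps)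
  also have "(\<Sum>b=1..j. smult (?c b) (?w b)) = (\<Sum>b=1..j. smult (?c b) (binomial_sum i (j - b)))"
  proof (rule sum.cong[OF refl])
    fix b assume "b \<in> {1..j}"
    then have "min i (?N - b) = i" "?N - b = i + (j - b) + 1" by auto
    then show "smult (?c b) (?w b) = smult (?c b) (binomial_sum i (j - b))"
      by (simp only: binomial_sum_def)
  qed
  also have "(\<Sum>b=j+1..?N. smult (?c b) (?w b)) =
      (\<Sum>b=j+1..?N. if ?N - b \<le> 1 then [:?c b:] else 0)"
  proof (rule sum.cong[OF refl])
    fix b assume "b \<in> {j+1..?N}"
    then have "min i (?N - b) = ?N - b" by auto
    then show "smult (?c b) (?w b) = (if ?N - b \<le> 1 then [:?c b:] else 0)"
      by (simp only: binomial_poly_Vandermonde) simp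
  qed
  also have "\<dots> = (\<Sum>b\<in>(if i \<ge> 1 then {i + j, ?N} else {?N}). [:?c b:])"
    by (rule sum.mono_neutral_cong_right) (auto split: if_splits)
  also have "\<dots> = [:?c ?N:] + (if i \<ge> 1 then [:?c (i + j):] else 0)"
    by (simp add: add.commute)
  finally have 3: "?r2 = (\<Sum>b=1..j. smult (?c b) (binomial_sum i (j - b)))
      + ([:?c ?N:] + (if i \<ge> 1 then [:?c (i + j):] else 0))" .
  have "pderiv (binomial_sum i j :: 'k poly) =
      (\<Sum>l\<le>i. pderiv (?u l) * ?v (?N - l) + ?u l * pderiv (?v (?N - l)))"
    unfolding binomial_sum_def by (simp add: pderiv_sum pderiv_mult algebra_simps)
  also have "\<dots> = - ?l1 + ?l2"
    by (simp add: du dv sum_distrib_left sum_distrib_right sum.distrib sum_negf sum_subtractf)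
  finally show ?thesis unfolding 1 2 3 by simp
qed

text \<open>
  At \<open>t = 0\<close> the factor \<open>e\<^bsup>tz\<^esup>\<close> of the generating function becomes \<open>1\<close>.
\<close>

lemma poly_bernoulli_poly_0:
  "poly (bernoulli_poly n) 0 = (bernoulli_number n :: 'k::field_char_0)"
proof -
  let ?b = "\<lambda>m. fps_nth (fps_X / (fps_exp 1 - 1)) m :: 'k"
  have "poly (\<Sum>m=0..n. [:?b m:] * monom (1 / fact (n - m)) (n - m)) 0 =
      ?b n"
    by (subst sum.remove[of _ n]) (auto simp: poly_sum poly_monom intro!: sum.neutral)
  then show ?thesis
    by (simp add: bernoulli_poly_def bernoulli_number_def fps_mult_nth)
qed

section \<open>The morphism relation at words with one function\<close>

lemma dga_opn_long: "length xs \<ge> 3 \<Longrightarrow> dga_opn d m xs = 0"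
  by (auto simp: dga_opn_def split: list.splits)

text \<open>
  Only cuts into one or two blocks contribute when the operations of the target have at most two
  arguments.
\<close>

lemma ainf_comp_dga:
  assumes "\<And>ys. length ys \<ge> 3 \<Longrightarrow> Q ys = 0" and "xs \<noteq> []"
  shows "ainf_comp Q F xs = Q [F xs] + (\<Sum>k=1..<length xs. Q [F (take k xs), F (drop k xs)])"
proof -
  let ?g = "\<lambda>k. [take k xs, drop k xs]"
  have ex: "length bs \<ge> 3 \<or> bs = [xs] \<or> (\<exists>k\<in>{1..<length xs}. bs = ?g k)" if "bs \<in> cuts xs" for bs
  proof -
    from that have bs: "concat bs = xs" "[] \<notin> set bs" by (auto simp: cuts_def)
    consider "bs = []" | b where "bs = [b]" | b c where "bs = [b, c]" | "length bs \<ge> 3"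
      by (cases bs; cases "tl bs"; cases "tl (tl bs)") auto
    then show ?thesis
    proof cases
      case (3 b c)
      then have "length b \<in> {1..<length xs}" "bs = ?g (length b)"
        using bs by (auto simp: Suc_le_eq)
      then show ?thesis by blast
    qed (use bs assms(2) in auto)
  qed
  have inj: "inj_on ?g {1..<length xs}"
  proof (rule inj_onI)
    fix k l assume "k \<in> {1..<length xs}" "l \<in> {1..<length xs}" "?g k = ?g l"
    then have "length (take k xs) = length (take l xs)" by simp
    with \<open>k \<in> _\<close> \<open>l \<in> _\<close> show "k = l" by simp
  qed
  have "ainf_comp Q F xs = (\<Sum>bs\<in>insert [xs] (?g ` {1..<length xs}). Q (map F bs))"
    unfolding ainf_comp_cuts
  proof (rule sum.mono_neutral_right[OF finite_cuts])
    show "insert [xs] (?g ` {1..<length xs}) \<subseteq> cuts xs"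
      using assms(2) by (auto simp: cuts_def)
    show "\<forall>bs\<in>cuts xs - insert [xs] (?g ` {1..<length xs}). Q (map F bs) = 0"
      using ex assms(1) by fastforce
  qed
  also have "\<dots> = Q [F xs] + (\<Sum>k=1..<length xs. Q [F (take k xs), F (drop k xs)])"
    by (subst sum.insert) (auto simp: sum.reindex[OF inj] simp del: One_nat_def)
  finally show ?thesis .
qed

lemma sum_prod_pair: "(\<Sum>i\<in>I. (0, f i)) = (0, \<Sum>i\<in>I. f i)"
  by (induction I rule: infinite_finite_induct) (auto simp: zero_prod_def)

lemma multilinear_scalars:
  assumes A: "graded_vector_space A" and B: "graded_vector_space B" and F: "multilinear A B F"
    and "set us \<subseteq> total_space A" "set vs \<subseteq> total_space A" "x \<in> total_space A"
  shows "F (us @ map (\<lambda>r. scal A r x) rs @ vs) =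
    scal B (prod_list rs) (F (us @ replicate (length rs) x @ vs))"
  using assms(4)
proof (induction rs arbitrary: us)
  interpret vector_space "scal B" using B by (simp add: graded_vector_space_def)
  case Nil
  show ?case by simp
next
  interpret vector_space "scal B" using B by (simp add: graded_vector_space_def)
  case (Cons r rs)
  have "set (map (\<lambda>r. scal A r x) rs @ vs) \<subseteq> total_space A"
    using assms(5,6) by (auto intro: total_space_scal[OF A])
  from multilinear_scal[OF F Cons.prems this assms(6), of r] Cons.IH[of "us @ [x]"] Cons.prems assms(6)
  show ?case by simp
qed

abbreviation (input) t_word :: "nat \<Rightarrow> nat \<Rightarrow> 'k::field_char_0 whitney list" where
  "t_word i j \<equiv> replicate i w_dt @ w_t # replicate j w_dt"

lemma total_space_two_term:
  assumes "graded_vector_space A" "part A = two_term_part UNIV UNIV"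
  shows "total_space A = (UNIV :: ('f::ab_group_add \<times> 'g::ab_group_add) set)"
proof -
  have "x \<in> total_space A" for x :: "'f \<times> 'g"
  proof -
    have "(fst x, 0) \<in> total_space A" "(0, snd x) \<in> total_space A"
      using assms part_total_space[of A "(fst x, 0)" 0] part_total_space[of A "(0, snd x)" 1]
      by (simp_all add: two_term_part_def)
    from total_space_add[OF assms(1) this] show ?thesis by simp
  qed
  then show ?thesis by auto
qed

text \<open>
  Among the operations at subwords of \<open>dt\<^sup>i t dt\<^sup>j\<close> only \<open>d t = dt\<close> and \<open>dt \<union> t = dt\<close> are nonzero. Both replace
  \<open>t\<close> by a form, the second one shortening the word, and both carry a minus sign from the suspension.
  The letters \<open>dt\<close> have suspended degree \<open>0\<close>, so there is no Koszul sign.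
\<close>

lemma comp_coderivation_t_word:
  fixes F :: "'a::field_char_0 whitney list \<Rightarrow> 'w::ab_group_add"
  assumes "multilinear cochains_cup B F"
    and "graded_vector_space (cochains_cup :: ('a, 'a whitney) ainf)"
    and ds: "ds = replicate i 1 @ 0 # replicate j 1"
  shows "comp_coderivation F (opn cochains_cup) ds (t_word i j) =
    - F (replicate (i + j + 1) w_dt) - (if i \<ge> 1 then F (replicate (i + j) w_dt) else 0)"
proof -
  let ?Q = "opn cochains_cup :: 'a whitney list \<Rightarrow> 'a whitney"
  let ?xs = "t_word i j :: 'a whitney list"
  have tot: "total_space (cochains_cup :: ('a, 'a whitney) ainf) = UNIV"
    using assms(2) by (rule total_space_two_term) (simp add: cochains_cup_def)
  have F0: "F (us @ 0 # vs) = 0" for us vs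
    using assms(1,2) by (intro multilinear_0) (auto simp: tot)
  have Fneg: "F (us @ (- x) # vs) = - F (us @ x # vs)" for us vs x
    using multilinear_signed[OF assms(2,1), of us vs x 1] by (simp add: tot signed_def)
  have nth: "?xs ! a = (if a = i then w_t else w_dt)" if "a < i + j + 1" for a
    using that by (auto simp: nth_append nth_Cons split: nat.splits)
  have take1: "take 1 (drop a ys) = [ys ! a]" if "a < length ys" for a and ys :: "'a whitney list"
    using that by (simp flip: Cons_nth_drop_Suc)
  have take2: "take 2 (drop a ys) = [ys ! a, ys ! (a + 1)]" if "a + 1 < length ys"
    for a and ys :: "'a whitney list"
    using that by (simp add: numeral_2_eq_2 flip: Cons_nth_drop_Suc)
  let ?I = "Sigma {..<i + j + 1} (\<lambda>a. {1..i + j + 1 - a})"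
  let ?T = "\<lambda>(a, k). signed (sdegree (take a ds))
      (F (take a ?xs @ ?Q (take k (drop a ?xs)) # drop (a + k) ?xs))"
  let ?J = "if i \<ge> 1 then {(i, 1), (i - 1, 2)} else {(i, 1)}"
  have Q: "?Q (take k (drop a ?xs)) = 0" if "(a, k) \<in> ?I - ?J" for a k
  proof -
    from that have a: "a < i + j + 1" and k: "1 \<le> k" "k \<le> i + j + 1 - a" and ne: "(a, k) \<notin> ?J"
      by auto
    consider "k = 1" | "k = 2" | "k \<ge> 3" using k by linarith
    then show ?thesis
    proof cases
      case 1
      have "take 1 (drop a ?xs) = [?xs ! a]"
        by (rule take1) (use a in simp)
      moreover have "a \<noteq> i" using ne 1 by (auto split: if_splits)
      ultimately show ?thesis
        using nth[OF a] 1 by (simp add: cochains_cup_def dga_opn_def whitney_d_def zero_prod_def)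
    next
      case 2
      then have a': "a + 1 < i + j + 1" using k by simp
      have "take 2 (drop a ?xs) = [?xs ! a, ?xs ! (a + 1)]"
        by (rule take2) (use a' in simp)
      moreover have "a + 1 \<noteq> i" using ne 2 by (auto split: if_splits)
      ultimately show ?thesis
        using nth[OF a] nth[OF a'] 2
        by (simp add: cochains_cup_def dga_opn_def parity_def cup_def zero_prod_def)
    next
      case 3
      then have "length (take k (drop a ?xs)) \<ge> 3" using a k by simp
      then show ?thesis unfolding cochains_cup_def by (simp add: dga_opn_long)
    qed
  qed
  have "comp_coderivation F ?Q ds ?xs = (\<Sum>x\<in>?I. ?T x)"
    unfolding comp_coderivation_def by (subst sum.Sigma) (auto intro!: sum.cong)
  also have "\<dots> = (\<Sum>x\<in>?J. ?T x)"
  proof (rule sum.mono_neutral_right)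
    show "\<forall>x\<in>?I - ?J. ?T x = 0"
    proof
      fix x assume x: "x \<in> ?I - ?J"
      obtain a k where ak: "x = (a, k)" by (cases x)
      show "?T x = 0" by (simp only: ak prod.case Q[OF x[unfolded ak]] F0 signed_0)
    qed
  qed auto
  also have "\<dots> = ?T (i, 1) + (if i \<ge> 1 then ?T (i - 1, 2) else 0)"
    by auto
  also have "?T (i, 1) = - F (replicate (i + j + 1) w_dt)"
  proof -
    have "sdegree (take i ds) = 0" by (simp add: ds sdegree_def sum_list_replicate)
    moreover have "?Q [w_t] = - w_dt"
      by (simp add: cochains_cup_def dga_opn_def whitney_d_def)
    ultimately show ?thesis
      by (simp add: signed_def Fneg replicate_add[symmetric] replicate_Suc[symmetric] del: basis_vector.simps replicate_Suc)
  qed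
  also have "(if i \<ge> 1 then ?T (i - 1, 2) else 0) = - (if i \<ge> 1 then F (replicate (i + j) w_dt) else 0)"
  proof (cases i)
    case (Suc p)
    have "sdegree (take p ds) = 0" by (simp add: ds sdegree_def Suc sum_list_replicate del: replicate_Suc)
    moreover have "?Q [w_dt, w_t] = - w_dt"
      by (simp add: cochains_cup_def dga_opn_def parity_def cup_def)
    moreover have "?xs = replicate p w_dt @ w_dt # w_t # replicate j w_dt"
      by (simp add: Suc replicate_append_same)
    ultimately have "?T (p, 2) = - F (replicate p w_dt @ w_dt # replicate j w_dt)"
      by (simp add: signed_def Fneg numeral_2_eq_2 del: basis_vector.simps)
    then show ?thesis
      by (simp add: Suc replicate_add[symmetric] replicate_Suc[symmetric] del: basis_vector.simps replicate_Suc)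
  qed simp
  finally show ?thesis by simp
qed

section \<open>The composite of log and mu\<close>

text \<open>
  A dg algebra of forms whose functions contain the polynomials, embedded by \<open>fn\<close>. Injectivity of \<open>fn\<close>
  turns equations between forms into equations between polynomials, so the differential equation can
  be solved once for all models.
\<close>

locale form_model =
  fixes \<Omega> :: "('k::field_char_0, 'f::ab_group_add \<times> 'f) ainf" and fn :: "'k poly \<Rightarrow> 'f"
  assumes fn_inject: "fn p = fn q \<Longrightarrow> p = q"
    and fn_add: "fn (p + q) = fn p + fn q"
    and scal_fn: "scal \<Omega> c (fn p, 0) = (fn (smult c p), 0)"
    and opn_d: "opn \<Omega> [(fn p, 0)] = (0, - fn (pderiv p))"
    and opn_function_form: "opn \<Omega> [(fn p, 0), (0, fn q)] = (0, fn (p * q))"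
    and opn_form_function: "opn \<Omega> [(0, fn q), (fn p, 0)] = (0, - fn (p * q))"
    and opn_long: "length xs \<ge> 3 \<Longrightarrow> opn \<Omega> xs = 0"
    and part_negative: "d < 0 \<Longrightarrow> part \<Omega> d = {0}"
begin

lemma fn_0: "fn 0 = 0"
  using fn_add[of 0 0] by simp

lemma fn_minus: "fn (- p) = - fn p"
  using fn_add[of p "- p"] by (simp add: fn_0 minus_unique)

lemma fn_diff: "fn (p - q) = fn p - fn q"
  using fn_add[of p "- q"] by (simp add: fn_minus)

lemma fn_sum: "fn (\<Sum>i\<in>I. p i) = (\<Sum>i\<in>I. fn (p i))"
  by (induction I rule: infinite_finite_induct) (auto simp: fn_0 fn_add)

end

locale log_mu = form_model \<Omega> fn
  for \<Omega> :: "('k::field_char_0, 'f::ab_group_add \<times> 'f) ainf" and fn +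
  fixes lg :: "'k whitney list \<Rightarrow> 'k whitney" and \<mu> :: "'k whitney list \<Rightarrow> 'f \<times> 'f"
  assumes lg: "is_log lg" and mu: "is_mu \<Omega> fn \<mu>"
begin

abbreviation "\<gamma> \<equiv> ainf_comp \<mu> lg"

lemma lg_morphism: "unital_ainf_morphism cochains_cup cochains_inf lg"
  and lg_linear: "lg [x] = x"
  and lg_zero: "length xs > 1 \<Longrightarrow> x \<in> set xs \<Longrightarrow> x \<in> part (cochains_cup :: ('k, 'k whitney) ainf) 0 \<Longrightarrow> lg xs = 0"
  and lg_dt: "n \<ge> 1 \<Longrightarrow> lg (replicate n w_dt) = whitney_scal (log_coeff n) w_dt"
  using lg unfolding is_log_def by blast+

lemma mu_morphism: "unital_ainf_morphism cochains_inf \<Omega> \<mu>"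
  and mu_linear: "\<mu> [x] = whitney_inclusion fn x"
  and mu_zero: "\<lbrakk>length xs \<ge> 2;
      set xs \<subseteq> part cochains_inf 0 \<union> part (cochains_inf :: ('k, 'k whitney) ainf) 1;
      length (filter (\<lambda>x. x \<in> part cochains_inf 0) xs) \<noteq> 1\<rbrakk> \<Longrightarrow> \<mu> xs = 0"
  and mu_t: "\<lbrakk>n \<ge> 1; i \<le> n\<rbrakk> \<Longrightarrow> \<mu> (t_word i (n - i)) =
      (fn (smult ((-1) ^ i * of_nat (n choose i) / fact (n + 1))
          (bernoulli_poly (n + 1) - [:bernoulli_number (n + 1):])), 0)"
  using mu unfolding is_mu_def by blast+

lemma gamma_morphism: "unital_ainf_morphism cochains_cup \<Omega> \<gamma>"
  using lg_morphism mu_morphism by (rule unital_ainf_morphism_comp)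

lemmas gvs_cup = unital_ainf_algebraD(1)[OF unital_ainf_morphismD(1)[OF lg_morphism]]
lemmas gvs_inf = unital_ainf_algebraD(1)[OF unital_ainf_morphismD(1)[OF mu_morphism]]
lemmas gvs_forms = unital_ainf_algebraD(1)[OF unital_ainf_morphismD(2)[OF mu_morphism]]

lemma total_inf: "total_space (cochains_inf :: ('k, 'k whitney) ainf) = UNIV"
  by (rule total_space_two_term[OF gvs_inf]) (simp add: cochains_inf_def)

lemma gamma_linear: "\<gamma> [x] = whitney_inclusion fn x"
  by (simp add: ainf_comp_cuts cuts_singleton lg_linear mu_linear)

text \<open>
  Every block of a cut of \<open>dt\<^sup>n\<close> is a power of \<open>dt\<close>.
\<close>

lemma lg_blocks_dt:
  assumes "concat bs = replicate n w_dt" "[] \<notin> set bs"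
  shows "map lg bs = map (\<lambda>r. whitney_scal r w_dt) (map (\<lambda>b. log_coeff (length b)) bs)"
proof -
  have "lg b = whitney_scal (log_coeff (length b)) w_dt" if "b \<in> set bs" for b
  proof -
    have "set b \<subseteq> set (concat bs)" using that by auto
    then have "set b \<subseteq> {w_dt}" unfolding assms(1) by auto
    then have "b = replicate (length b) w_dt"
      by (intro replicate_eqI) auto
    moreover have "b \<noteq> []" using that assms(2) by auto
    then have "length b \<ge> 1" by (simp add: Suc_le_eq)
    ultimately show ?thesis using lg_dt[of "length b"] by metis
  qed
  then show ?thesis by simp
qed

text \<open>
  A cut into several blocks leaves several nonzero multiples of \<open>dt\<close>, hence no function, as arguments
  of \<open>\<mu>\<close>, which then vanishes. That they are nonzero matters, because \<open>0\<close> counts as a function.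
\<close>

lemma gamma_dt:
  assumes "n \<ge> 1"
  shows "\<gamma> (replicate n w_dt) = (0, fn [:log_coeff n:])"
proof -
  let ?xs = "replicate n w_dt :: 'k whitney list"
  have "\<mu> (map lg bs) = 0" if "bs \<in> cuts ?xs" "bs \<noteq> [?xs]" for bs
  proof (rule mu_zero)
    from that have bs: "concat bs = ?xs" "[] \<notin> set bs" by (auto simp: cuts_def)
    note m = lg_blocks_dt[OF bs]
    have "bs \<noteq> []" using bs assms by auto
    moreover have "bs \<noteq> [b]" for b using that bs by auto
    ultimately show "length (map lg bs) \<ge> 2" by (cases bs; cases "tl bs") auto
    show "set (map lg bs) \<subseteq> part cochains_inf 0 \<union> part (cochains_inf :: ('k, 'k whitney) ainf) 1"
      unfolding m by (auto simp: cochains_inf_def two_term_part_def whitney_scal_def zero_prod_def)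
    have "b \<noteq> []" if "b \<in> set bs" for b using that bs(2) by auto
    then have "filter (\<lambda>x. x \<in> part cochains_inf 0) (map lg bs) = []"
      unfolding m
      by (fastforce simp: filter_empty_conv cochains_inf_def two_term_part_def whitney_scal_def)
    then show "length (filter (\<lambda>x. x \<in> part cochains_inf 0) (map lg bs)) \<noteq> 1" by simp
  qed
  moreover have "[?xs] \<in> cuts ?xs" using assms by (auto simp: cuts_def)
  ultimately have "\<gamma> ?xs = \<mu> [lg ?xs]"
    by (simp add: ainf_comp_cuts sum.remove[OF finite_cuts])
  then show ?thesis
    unfolding lg_dt[OF assms] mu_linear
    by (simp add: whitney_inclusion_def whitney_scal_def fn_0)
qed

text \<open>
  The vanishing at \<open>t = 0\<close>, due to \<open>B\<^sub>n(0) = B\<^sub>n\<close>, is what will provide the initial value for the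
  differential equation.
\<close>

lemma mu_t_word: "\<exists>P. \<mu> (t_word p q) = (fn P, 0) \<and> poly P 0 = 0"
proof (cases "p + q = 0")
  case True
  then show ?thesis
    by (intro exI[of _ "[:0, 1:]"]) (simp add: mu_linear whitney_inclusion_def fn_0)
next
  case False
  then show ?thesis
    using mu_t[of "p + q" p] by (auto simp: poly_bernoulli_poly_0)
qed

lemma mu_scaled_t_word:
  "\<exists>P. \<mu> (map (\<lambda>r. whitney_scal r w_dt) rs @ w_t # map (\<lambda>r. whitney_scal r w_dt) ss) = (fn P, 0) \<and>
    poly P 0 = 0"
proof -
  have scal: "scal (cochains_inf :: ('k, 'k whitney) ainf) = whitney_scal"
    by (simp add: cochains_inf_def)
  note pull = multilinear_scalars[OF gvs_inf gvs_forms unital_ainf_morphismD(3)[OF mu_morphism],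
      unfolded total_inf scal, OF subset_UNIV subset_UNIV UNIV_I]
  obtain P where P: "\<mu> (t_word (length rs) (length ss)) = (fn P, 0)" "poly P 0 = 0"
    using mu_t_word by blast
  have "\<mu> (map (\<lambda>r. whitney_scal r w_dt) rs @ w_t # map (\<lambda>r. whitney_scal r w_dt) ss) =
      scal \<Omega> (prod_list rs) (scal \<Omega> (prod_list ss) (\<mu> (t_word (length rs) (length ss))))"
    using pull[of "[]" w_dt rs "w_t # map (\<lambda>r. whitney_scal r w_dt) ss"]
      pull[of "replicate (length rs) w_dt @ [w_t]" w_dt ss "[]"] by simp
  then show ?thesis
    using P by (intro exI[of _ "smult (prod_list rs) (smult (prod_list ss) P)"]) (simp add: scal_fn)
qed

text \<open>
  The functions \<open>fn P\<close> with \<open>P(0) = 0\<close> form a subspace, and every cut contributes an element of it: either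
  \<open>t\<close> is a block of its own and \<open>\<mu>\<close> is applied to multiples of \<open>dt\<close> around \<open>t\<close>, or \<open>log\<close> vanishes at the block
  of \<open>t\<close>.
\<close>

lemma gamma_t_word: "\<exists>P. \<gamma> (t_word i j) = (fn P, 0) \<and> poly P 0 = 0"
proof -
  let ?Z = "\<lambda>y. \<exists>P. y = (fn P, 0) \<and> poly P 0 = 0"
  have Z0: "?Z 0" by (intro exI[of _ 0]) (simp add: fn_0 zero_prod_def)
  have Z_add: "?Z (x + y)" if xy: "?Z x" "?Z y" for x y :: "'f \<times> 'f"
  proof -
    obtain P Q where "x = (fn P, 0)" "poly P 0 = 0" "y = (fn Q, 0)" "poly Q 0 = 0"
      using xy by blast
    then show ?thesis by (intro exI[of _ "P + Q"]) (simp add: fn_add)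
  qed
  have Z_sum: "?Z (sum f I)" if "\<And>x. x \<in> I \<Longrightarrow> ?Z (f x)" for f :: "'z \<Rightarrow> 'f \<times> 'f" and I
    using that
  proof (induction I rule: infinite_finite_induct)
    case (insert x I)
    then show ?case using Z_add[of "f x" "sum f I"] by simp
  qed (use Z0 in simp_all)
  have "?Z (\<mu> (map lg us @ lg (a @ w_t # c) # map lg vs))"
    if u: "concat us @ a = replicate i w_dt" "[] \<notin> set us"
      and v: "c @ concat vs = replicate j w_dt" "[] \<notin> set vs" for us a c vs
  proof (cases "a = [] \<and> c = []")
    case True
    then have dt: "concat us = replicate i w_dt" "concat vs = replicate j w_dt"
      and t: "lg (a @ w_t # c) = w_t"
      using u v by (simp_all add: lg_linear)
    show ?thesis
      unfolding t lg_blocks_dt[OF dt(1) u(2)] lg_blocks_dt[OF dt(2) v(2)] by (rule mu_scaled_t_word)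
  next
    case False
    then have "lg (a @ w_t # c) = 0"
      by (intro lg_zero[of _ w_t]) (auto simp: cochains_cup_def two_term_part_def neq_Nil_conv)
    moreover have "\<mu> (map lg us @ 0 # map lg vs) = 0"
      by (intro multilinear_0[OF gvs_inf unital_ainf_morphismD(3)[OF mu_morphism]])
        (auto simp: total_inf)
    ultimately show ?thesis using Z0 by simp
  qed
  then show ?thesis
    unfolding ainf_comp_at_entry
    by (intro Z_sum) (auto simp: left_cuts_def right_cuts_def)
qed

text \<open>
  This is the morphism relation of \<open>\<gamma>\<close> at \<open>dt\<^sup>i t dt\<^sup>j\<close>. The derivative comes from \<open>d\<close>, and the two sums come
  from the products of \<open>\<gamma> (dt\<^sup>a)\<close> on the left and \<open>\<gamma> (dt\<^sup>b)\<close> on the right; their signs differ since a form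
  on the left of a function acquires the sign of its degree in \<open>Q\<^sub>2\<close>. The constants are
  \<open>\<gamma> (dt\<^bsup>i+j+1\<^esup>)\<close> and \<open>\<gamma> (dt\<^bsup>i+j\<^esup>)\<close>, which come from \<open>d t\<close> and \<open>dt \<union> t\<close>.
\<close>

lemma gamma_recursion:
  assumes P: "\<And>i j. \<gamma> (t_word i j) = (fn (P i j), 0)"
  shows "pderiv (P i j) =
     [:log_coeff (i + j + 1):] + (if i \<ge> 1 then [:log_coeff (i + j):] else 0)
     - (\<Sum>a=1..i. smult (log_coeff a) (P (i - a) j))
     + (\<Sum>b=1..j. smult (log_coeff b) (P i (j - b)))"
proof -
  let ?Q = "opn \<Omega>" and ?xs = "t_word i j :: 'k whitney list"
  let ?ds = "replicate i 1 @ 0 # replicate j (1::int)"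
  let ?S = "\<lambda>k. ?Q [\<gamma> (take k ?xs), \<gamma> (drop k ?xs)]"
  have deg: "has_degrees cochains_cup ?xs ?ds"
    by (auto simp: has_degrees_def list_all2_append list_all2_conv_all_nth cochains_cup_def
        two_term_part_def zero_prod_def nth_append nth_Cons split: nat.splits)
  have "ainf_comp ?Q \<gamma> ?xs = comp_coderivation \<gamma> (opn cochains_cup) ?ds ?xs"
    by (rule unital_ainf_morphismD(5)[OF gamma_morphism _ deg]) simp
  also have "\<dots> = - \<gamma> (replicate (i + j + 1) w_dt) - (if i \<ge> 1 then \<gamma> (replicate (i + j) w_dt) else 0)"
    by (rule comp_coderivation_t_word[OF unital_ainf_morphismD(3)[OF gamma_morphism] gvs_cup refl])
  also have "\<dots> = (0, fn (- [:log_coeff (i + j + 1):] - (if i \<ge> 1 then [:log_coeff (i + j):] else 0)))"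
    using gamma_dt[of "i + j + 1"] gamma_dt[of "i + j"]
    by (auto simp: fn_minus fn_diff fn_0 zero_prod_def
        simp del: basis_vector.simps replicate_Suc minus_pCons diff_pCons)
  finally have rhs: "ainf_comp ?Q \<gamma> ?xs = \<dots>" .
  have left: "?S k = (0, fn (- smult (log_coeff k) (P (i - k) j)))" if "k \<in> {1..i}" for k
  proof -
    have "take k ?xs = replicate k w_dt" "drop k ?xs = t_word (i - k) j" using that by auto
    then show ?thesis
      using that gamma_dt[of k] by (simp only: P) (simp add: opn_form_function fn_minus del: basis_vector.simps)
  qed
  have right: "?S (i + j + 1 - b) = (0, fn (smult (log_coeff b) (P i (j - b))))" if "b \<in> {1..j}" for b
  proof -
    have "take (i + j + 1 - b) ?xs = t_word i (j - b)" "drop (i + j + 1 - b) ?xs = replicate b w_dt"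
      using that by (auto simp: Suc_diff_le)
    then show ?thesis
      using that gamma_dt[of b] by (simp only: P) (simp add: opn_function_form del: basis_vector.simps)
  qed
  have "ainf_comp ?Q \<gamma> ?xs = ?Q [\<gamma> ?xs] + (\<Sum>k=1..<i + j + 1. ?S k)"
    using ainf_comp_dga[OF opn_long, where xs = ?xs and F = \<gamma>] by simp
  also have "(\<Sum>k=1..<i + j + 1. ?S k) = (\<Sum>k\<in>{1..i}. ?S k) + (\<Sum>k\<in>{i+1..<i + j + 1}. ?S k)"
  proof -
    have "{1..<i + j + 1} = {1..i} \<union> {i + 1..<i + j + 1}" by auto
    then show ?thesis by (simp only:) (rule sum.union_disjoint; auto)
  qed
  also have "(\<Sum>k\<in>{i+1..<i + j + 1}. ?S k) = (\<Sum>b=1..j. ?S (i + j + 1 - b))"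
    by (rule sum.reindex_bij_witness[of _ "\<lambda>b. i + j + 1 - b" "\<lambda>k. i + j + 1 - k"]) auto
  also have "(\<Sum>b=1..j. ?S (i + j + 1 - b)) = (\<Sum>b=1..j. (0, fn (smult (log_coeff b) (P i (j - b)))))"
    by (rule sum.cong[OF refl right])
  also have "(\<Sum>k\<in>{1..i}. ?S k) = (\<Sum>k=1..i. (0, fn (- smult (log_coeff k) (P (i - k) j))))"
    by (rule sum.cong[OF refl left])
  also have "?Q [\<gamma> ?xs] = (0, fn (- pderiv (P i j)))"
    by (simp only: P opn_d fn_minus)
  finally have "ainf_comp ?Q \<gamma> ?xs = (0, fn (- pderiv (P i j)
      + (- (\<Sum>a=1..i. smult (log_coeff a) (P (i - a) j)) + (\<Sum>b=1..j. smult (log_coeff b) (P i (j - b))))))"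
    by (simp add: fn_add fn_minus fn_diff fn_sum sum_negf sum_prod_pair)
  with rhs have "- pderiv (P i j)
      + (- (\<Sum>a=1..i. smult (log_coeff a) (P (i - a) j)) + (\<Sum>b=1..j. smult (log_coeff b) (P i (j - b)))) =
      - [:log_coeff (i + j + 1):] - (if i \<ge> 1 then [:log_coeff (i + j):] else 0)"
    by (auto dest: fn_inject)
  then show ?thesis by (simp add: algebra_simps del: minus_pCons)
qed

text \<open>
  The recursion expresses the derivative through the polynomials with smaller \<open>i + j\<close>. In characteristic
  zero the derivative and the value at \<open>0\<close> determine a polynomial.
\<close>

lemma gamma_t: "\<gamma> (t_word i j) = (fn (binomial_sum i j), 0)"
proof -
  obtain P where P: "\<And>i j. \<gamma> (t_word i j) = (fn (P i j), 0)" "\<And>i j. poly (P i j) 0 = 0"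
    using gamma_t_word by metis
  have "P i j = binomial_sum i j"
  proof (induction "i + j" arbitrary: i j rule: less_induct)
    case less
    have "pderiv (P i j) = pderiv (binomial_sum i j)"
      unfolding gamma_recursion[OF P(1)] pderiv_binomial_sum
      by (intro arg_cong2[of _ _ _ _ "(+)"] arg_cong2[of _ _ _ _ "(-)"] sum.cong refl
          arg_cong2[of _ _ _ _ smult] less) auto
    then have "pderiv (P i j - binomial_sum i j) = 0" by (simp add: pderiv_diff)
    then obtain c where c: "P i j - binomial_sum i j = [:c:]"
      by (auto simp: pderiv_eq_0_iff elim: degree_eq_zeroE)
    have "poly (P i j - binomial_sum i j) 0 = 0" by (simp add: P(2) poly_binomial_sum_0)
    then show ?case using c by simp
  qed
  then show ?thesis by (simp only: P(1))
qed

end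

section \<open>Determination by the values at words\<close>

fun basis_degree :: "whitney_basis \<Rightarrow> int" where
  "basis_degree DT = 1"
| "basis_degree _ = 0"

lemma multilinear_eq_on_basis:
  fixes F G :: "'k::field_char_0 whitney list \<Rightarrow> 'w::ab_group_add"
  assumes lin: "multilinear A B F" "multilinear A B G"
    and A: "scal A = whitney_scal" "total_space A = UNIV"
    and eq: "\<And>ws. ws \<noteq> [] \<Longrightarrow> F (map basis_vector ws) = G (map basis_vector ws)"
    and "xs \<noteq> []"
  shows "F xs = G xs"
proof -
  have "F (map basis_vector ws @ xs) = G (map basis_vector ws @ xs)" if "ws \<noteq> [] \<or> xs \<noteq> []" for ws
    using that
  proof (induction xs arbitrary: ws)
    case Nil
    then show ?case using eq by simp
  next
    case (Cons x xs)
    have IH: "F (map basis_vector ws @ basis_vector w # xs) = G (map basis_vector ws @ basis_vector w # xs)" for w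
      using Cons.IH[of "ws @ [w]"] by simp
    have expand: "H (us @ x # xs) =
        scal B (coordinate Unit x) (H (us @ w_one # xs)) + scal B (coordinate T x) (H (us @ w_t # xs))
        + scal B (coordinate DT x) (H (us @ w_dt # xs))" if H: "multilinear A B H" for H us
    proof -
      note add = multilinear_add[OF H, unfolded A, OF subset_UNIV subset_UNIV UNIV_I UNIV_I]
      note scal = multilinear_scal[OF H, unfolded A, OF subset_UNIV subset_UNIV UNIV_I]
      show ?thesis by (subst basis_expansion[of x]) (simp only: add scal)
    qed
    show ?case by (simp only: expand[OF lin(1)] expand[OF lin(2)] IH)
  qed
  from this[of "[]"] assms(6) show ?thesis by simp
qed

context form_model
begin

text \<open>
  It suffices to compare values at words in \<open>1\<close>, \<open>t\<close> and \<open>dt\<close>. The value at a word with \<open>k\<close> letters \<open>t\<close> and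
  otherwise letters \<open>dt\<close> has degree \<open>1 - k\<close>, and there are no forms of negative degree.
\<close>

lemma morphism_determined:
  assumes F: "unital_ainf_morphism cochains_cup \<Omega> F" and G: "unital_ainf_morphism cochains_cup \<Omega> G"
    and linear: "\<And>x. F [x] = G [x]"
    and one: "\<And>i j. F (t_word i j) = G (t_word i j)"
    and none: "\<And>n. n \<ge> 1 \<Longrightarrow> F (replicate n w_dt) = G (replicate n w_dt)"
    and "xs \<noteq> []"
  shows "F xs = G xs"
proof -
  let ?A = "cochains_cup :: ('k, 'k whitney) ainf"
  have tot: "total_space ?A = UNIV"
    by (rule total_space_two_term[OF unital_ainf_algebraD(1)[OF unital_ainf_morphismD(1)[OF F]]])
      (simp add: cochains_cup_def)
  have degrees: "has_degrees ?A (map basis_vector ws) (map basis_degree ws)" for ws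
  proof -
    have "basis_vector w \<in> part ?A (basis_degree w)" for w
      by (cases w) (auto simp: cochains_cup_def two_term_part_def zero_prod_def)
    then show ?thesis by (simp add: has_degrees_map)
  qed
  have many: "H (map basis_vector (us @ T # vs @ T # ws)) = 0"
    if H: "unital_ainf_morphism cochains_cup \<Omega> H" for H us vs ws
  proof -
    have le_one: "basis_degree w \<le> 1" for w by (cases w) simp_all
    have nonpos: "sdegree (map basis_degree ws) \<le> 0" for ws
    proof (induction ws)
      case (Cons w ws)
      with le_one[of w] show ?case by (simp add: sdegree_def)
    qed (simp add: sdegree_def)
    let ?ws = "us @ T # vs @ T # ws"
    have "sdegree (map basis_degree ?ws) \<le> -2"
      using nonpos[of us] nonpos[of vs] nonpos[of ws] by (simp add: sdegree_def)
    moreover have "H (map basis_vector ?ws) \<in> part \<Omega> (sdegree (map basis_degree ?ws) + 0 + 1)"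
      using unital_ainf_morphismD(4)[OF H] degrees[of ?ws] unfolding homogeneous_of_degree_def by blast
    ultimately show ?thesis using part_negative by simp
  qed
  have "F (map basis_vector ws) = G (map basis_vector ws)" if "ws \<noteq> []" for ws
  proof -
    consider w where "ws = [w]" | "length ws \<ge> 2" "Unit \<in> set ws"
      | "Unit \<notin> set ws" "T \<notin> set ws" | "Unit \<notin> set ws" "T \<in> set ws"
      using that by (cases ws; cases "tl ws") auto
    then show ?thesis
    proof cases
      case 1
      then show ?thesis by (simp add: linear)
    next
      case 2
      then have "unt ?A \<in> set (map basis_vector ws)"
        unfolding cochains_cup_def by force
      then show ?thesis
        using 2 tot unital_ainf_morphismD(7)[OF F] unital_ainf_morphismD(7)[OF G] by simp
    next
      case 3
      then have "w = DT" if "w \<in> set ws" for w using that by (cases w) auto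
      then have "ws = replicate (length ws) DT" by (intro replicate_eqI) auto
      then have "map basis_vector ws = replicate (length ws) (w_dt :: 'k whitney)"
        by (metis map_replicate)
      then show ?thesis using none[of "length ws"] that by (simp add: Suc_le_eq)
    next
      case 4
      then obtain us vs where ws: "ws = us @ T # vs" "T \<notin> set us" by (meson split_list_first)
      show ?thesis
      proof (cases "T \<in> set vs")
        case True
        then obtain vs1 vs2 where "vs = vs1 @ T # vs2" by (meson split_list)
        then show ?thesis using many[OF F] many[OF G] ws(1) by simp
      next
        case False
        have "w = DT" if "w \<in> set us \<union> set vs" for w using that False ws 4 by (cases w) auto
        then have "us = replicate (length us) DT" "vs = replicate (length vs) DT"
          by (auto intro!: replicate_eqI)
        then have "map basis_vector ws = (t_word (length us) (length vs) :: 'k whitney list)"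
          unfolding ws(1) by (metis map_append list.simps(9) map_replicate)
        then show ?thesis using one by simp
      qed
    qed
  qed
  then show ?thesis
    using multilinear_eq_on_basis[OF unital_ainf_morphismD(3)[OF F] unital_ainf_morphismD(3)[OF G] _ tot _ assms(6)]
    by (simp add: cochains_cup_def)
qed

end

lemma (in log_mu) gamma_determined:
  "\<forall>\<gamma>'. unital_ainf_morphism cochains_cup \<Omega> \<gamma>' \<and> (\<forall>x. \<gamma>' [x] = \<gamma> [x]) \<and>
     (\<forall>i j. \<gamma>' (t_word i j) = \<gamma> (t_word i j)) \<and>
     (\<forall>n\<ge>1. \<gamma>' (replicate n w_dt) = \<gamma> (replicate n w_dt)) \<longrightarrow>
     (\<forall>xs. xs \<noteq> [] \<longrightarrow> \<gamma>' xs = \<gamma> xs)"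
proof (intro allI impI, elim conjE)
  fix \<gamma>' and xs :: "'k whitney list"
  assume "unital_ainf_morphism cochains_cup \<Omega> \<gamma>'" and "\<forall>x. \<gamma>' [x] = \<gamma> [x]"
    and "\<forall>i j. \<gamma>' (t_word i j) = \<gamma> (t_word i j)"
    and "\<forall>n\<ge>1. \<gamma>' (replicate n w_dt) = \<gamma> (replicate n w_dt)" and "xs \<noteq> []"
  note eq = this
  show "\<gamma>' xs = \<gamma> xs"
    by (rule morphism_determined[OF eq(1) gamma_morphism eq(2-4)[rule_format] eq(5)])
qed

section \<open>Polynomial and smooth forms\<close>

lemma form_model_poly: "form_model (poly_forms :: ('k::field_char_0, 'k poly \<times> 'k poly) ainf) poly_fn"
proof
  fix p q :: "'k poly" and c :: 'k and xs :: "('k poly \<times> 'k poly) list" and d :: int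
  show "opn poly_forms xs = 0" if "length xs \<ge> 3"
    using that by (simp add: poly_forms_def dga_opn_long)
  show "part poly_forms d = ({0} :: ('k poly \<times> 'k poly) set)" if "d < 0"
    using that by (simp add: poly_forms_def two_term_part_def)
qed (simp_all add: poly_fn_def poly_forms_def dga_opn_def parity_def wedge_def)

lemma on_unit_interval_eq_iff:
  "on_unit_interval f = on_unit_interval g \<longleftrightarrow> (\<forall>x\<in>{0..1}. f x = g x)"
proof (intro iffI ballI)
  fix x :: real assume eq: "on_unit_interval f = on_unit_interval g" and x: "x \<in> {0..1}"
  have "on_unit_interval f x = on_unit_interval g x" by (simp only: eq)
  with x show "f x = g x" by (simp add: on_unit_interval_def)
qed (simp add: on_unit_interval_def fun_eq_iff)

lemma form_model_smooth: "form_model smooth_forms smooth_fn"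
proof
  fix p q :: "real poly" and c :: real and xs :: "((real \<Rightarrow> real) \<times> (real \<Rightarrow> real)) list" and d :: int
  show "p = q" if "smooth_fn p = smooth_fn q"
  proof (rule ccontr)
    assume "p \<noteq> q"
    \<comment> \<open>A polynomial vanishing on the whole interval has too many roots.\<close>
    then have "finite {x. poly (p - q) x = 0}" by (intro poly_roots_finite) simp
    moreover have "{0..1} \<subseteq> {x. poly (p - q) x = 0}"
      using that by (auto simp: smooth_fn_def on_unit_interval_eq_iff)
    ultimately have "finite {0..1::real}" by (rule rev_finite_subset)
    then show False using infinite_Icc[of "0::real" 1] zero_less_one by blast
  qed
  show "smooth_fn (p + q) = smooth_fn p + smooth_fn q"
    by (auto simp: smooth_fn_def on_unit_interval_def fun_eq_iff)
  show "scal smooth_forms c (smooth_fn p, 0) = (smooth_fn (smult c p), 0)"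
    by (auto simp: smooth_forms_def smooth_fn_def on_unit_interval_def fun_eq_iff)
  have "vector_derivative (smooth_fn p) (at x within {0..1}) = poly (pderiv p) x" if "x \<in> {0..1}" for x
  proof (rule vector_derivative_within_closed_interval)
    have "(poly p has_vector_derivative poly (pderiv p) x) (at x within {0..1})"
      unfolding has_real_derivative_iff_has_vector_derivative[symmetric]
      by (rule has_field_derivative_at_within[OF poly_DERIV])
    then show "(smooth_fn p has_vector_derivative poly (pderiv p) x) (at x within {0..1})"
      using has_vector_derivative_transform[OF that, of "smooth_fn p" "poly p"]
      by (simp add: smooth_fn_def on_unit_interval_def)
  qed (use that in simp_all)
  then show "opn smooth_forms [(smooth_fn p, 0)] = (0, - smooth_fn (pderiv p))"
    by (auto simp: smooth_forms_def dga_opn_def smooth_fn_def[of "pderiv p"] on_unit_interval_def fun_eq_iff)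
  show "opn smooth_forms [(smooth_fn p, 0), (0, smooth_fn q)] = (0, smooth_fn (p * q))"
    "opn smooth_forms [(0, smooth_fn q), (smooth_fn p, 0)] = (0, - smooth_fn (p * q))"
    by (auto simp: smooth_forms_def dga_opn_def parity_def wedge_def smooth_fn_def
        on_unit_interval_def fun_eq_iff)
  show "opn smooth_forms xs = 0" if "length xs \<ge> 3"
    using that by (simp add: smooth_forms_def dga_opn_long)
  show "part smooth_forms d = {0}" if "d < 0"
    using that by (simp add: smooth_forms_def two_term_part_def)
qed

theorem proposition1p7:
  shows
    "(\<forall>(lg :: 'k::field_char_0 whitney list \<Rightarrow> 'k whitney)
        (\<mu> :: 'k whitney list \<Rightarrow> 'k poly \<times> 'k poly) \<gamma>.
        is_log lg \<and> is_mu poly_forms poly_fn \<mu> \<and> \<gamma> = ainf_comp \<mu> lg \<longrightarrow>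
        unital_ainf_morphism cochains_cup poly_forms \<gamma> \<and>
        (\<forall>x. \<gamma> [x] = whitney_inclusion poly_fn x) \<and>
        (\<forall>i j. \<gamma> (replicate i w_dt @ w_t # replicate j w_dt) =
           (\<Sum>l\<le>i. binomial_poly [:1, -1:] l * binomial_poly [:0, 1:] (i + j + 1 - l), 0)) \<and>
        (\<forall>n\<ge>1. \<gamma> (replicate n w_dt) = (0, [:(-1) ^ (n + 1) / of_nat n:])) \<and>
        (\<forall>\<gamma>'. unital_ainf_morphism cochains_cup poly_forms \<gamma>' \<and>
           (\<forall>x. \<gamma>' [x] = \<gamma> [x]) \<and>
           (\<forall>i j. \<gamma>' (replicate i w_dt @ w_t # replicate j w_dt) =
                  \<gamma> (replicate i w_dt @ w_t # replicate j w_dt)) \<and>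
           (\<forall>n\<ge>1. \<gamma>' (replicate n w_dt) = \<gamma> (replicate n w_dt)) \<longrightarrow>
           (\<forall>xs. xs \<noteq> [] \<longrightarrow> \<gamma>' xs = \<gamma> xs)))
     \<and>
     (\<forall>(lg :: real whitney list \<Rightarrow> real whitney)
        (\<mu> :: real whitney list \<Rightarrow> (real \<Rightarrow> real) \<times> (real \<Rightarrow> real)) \<gamma>.
        is_log lg \<and> is_mu smooth_forms smooth_fn \<mu> \<and> \<gamma> = ainf_comp \<mu> lg \<longrightarrow>
        unital_ainf_morphism cochains_cup smooth_forms \<gamma> \<and>
        (\<forall>x. \<gamma> [x] = whitney_inclusion smooth_fn x) \<and>
        (\<forall>i j. \<gamma> (replicate i w_dt @ w_t # replicate j w_dt) =
           (on_unit_interval (\<lambda>t. \<Sum>l\<le>i. ((1 - t) gchoose l) * (t gchoose (i + j + 1 - l))), 0)) \<and>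
        (\<forall>n\<ge>1. \<gamma> (replicate n w_dt) = (0, on_unit_interval (\<lambda>t. (-1) ^ (n + 1) / of_nat n))) \<and>
        (\<forall>\<gamma>'. unital_ainf_morphism cochains_cup smooth_forms \<gamma>' \<and>
           (\<forall>x. \<gamma>' [x] = \<gamma> [x]) \<and>
           (\<forall>i j. \<gamma>' (replicate i w_dt @ w_t # replicate j w_dt) =
                  \<gamma> (replicate i w_dt @ w_t # replicate j w_dt)) \<and>
           (\<forall>n\<ge>1. \<gamma>' (replicate n w_dt) = \<gamma> (replicate n w_dt)) \<longrightarrow>
           (\<forall>xs. xs \<noteq> [] \<longrightarrow> \<gamma>' xs = \<gamma> xs)))"
proof ((rule conjI; intro allI impI; elim conjE), goal_cases)
  case (1 lg \<mu> \<gamma>)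
  interpret log_mu poly_forms poly_fn lg \<mu>
    by (rule log_mu.intro[OF form_model_poly log_mu_axioms.intro[OF 1(1,2)]])
  show ?case
    unfolding 1(3)
  proof (intro conjI gamma_morphism gamma_determined allI impI gamma_linear)
    fix i j
    show "ainf_comp \<mu> lg (t_word i j) =
        (\<Sum>l\<le>i. binomial_poly [:1, -1:] l * binomial_poly [:0, 1:] (i + j + 1 - l), 0)"
      unfolding gamma_t by (simp add: poly_fn_def binomial_sum_def)
  next
    fix n :: nat assume "n \<ge> 1"
    then have "ainf_comp \<mu> lg (replicate n w_dt) = (0, poly_fn [:log_coeff n:])"
      by (rule gamma_dt)
    then show "ainf_comp \<mu> lg (replicate n w_dt) = (0, [:(-1) ^ (n + 1) / of_nat n:])"
      by (simp only: poly_fn_def)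
  qed
next
  case (2 lg \<mu> \<gamma>)
  interpret log_mu smooth_forms smooth_fn lg \<mu>
    by (rule log_mu.intro[OF form_model_smooth log_mu_axioms.intro[OF 2(1,2)]])
  show ?case
    unfolding 2(3)
  proof (intro conjI gamma_morphism gamma_determined allI impI gamma_linear)
    fix i j
    show "ainf_comp \<mu> lg (t_word i j) =
        (on_unit_interval (\<lambda>t. \<Sum>l\<le>i. ((1 - t) gchoose l) * (t gchoose (i + j + 1 - l))), 0)"
      unfolding gamma_t smooth_fn_def by (simp only: poly_binomial_sum[abs_def])
  next
    fix n :: nat assume "n \<ge> 1"
    then have "ainf_comp \<mu> lg (replicate n w_dt) = (0, smooth_fn [:log_coeff n:])"
      by (rule gamma_dt)
    then show "ainf_comp \<mu> lg (replicate n w_dt) = (0, on_unit_interval (\<lambda>t. (-1) ^ (n + 1) / of_nat n))"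
      by (simp add: smooth_fn_def on_unit_interval_def cong: if_cong)
  qed
qed

end
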